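(* Let $(\Omega,\Sigma)$ be a measurable space and let $X$ be a real Banach space containing no subspace isomorphic to $c_0(\omega_1)$. Then every multimeasure $M:\Sigma\to b(X)$ admits a control measure.
   Context: By a subspace of a Banach space is meant a norm-closed linear subspace; isomorphic means linearly homeomorphic; $\omega_1$ is the first uncountable ordinal. $b(X)$ is the family of all bounded non-empty subsets of $X$. For $C\in b(X)$ and $x^*\in X^*$, $s(x^*,C):=\sup\{x^*(x): x\in C\}$. ${\rm ca}(\Sigma)$ is the set of all countably additive real-valued (signed, finite) measures on $\Sigma$, and ${\rm ca}^+(\Sigma)$ is the subset of finite non-negative measures. A map $M:\Sigma\to b(X)$ is a multimeasure if for each $x^*\in X^*$ the map $A\mapsto s(x^*,M(A))$ belongs to ${\rm ca}(\Sigma)$. A measure $\mu\in{\rm ca}^+(\Sigma)$ is a control measure of $M$ if $M(A)=\{0\}$ for every $A\in\Sigma$ with $\mu(A)=0$. *)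

theory Defs
  imports "HOL-Analysis.Analysis"
begin

text \<open>\<open>cardSuc natLeq\<close> is a cardinal order, i.e. a well-order of minimal order type among those
  on its field, and it is the successor cardinal of \<open>natLeq\<close>. So its order type is the first
  uncountable ordinal, whose elements the following type represents.\<close>

typedef omega1 = "Field (cardSuc natLeq)"
  using cardSuc_finite[OF natLeq_Card_order] natLeq_card_order
  by (metis Field_natLeq equals0I finite.emptyI infinite_UNIV_nat)

lemma card_of_omega1:
  includes cardinal_syntax
  shows "|UNIV :: omega1 set| =o cardSuc natLeq"
proof -
  have "bij_betw Rep_omega1 UNIV (Field (cardSuc natLeq))"
    unfolding bij_betw_def
    by (metis Rep_omega1_inject injI type_definition.Rep_range type_definition_omega1)
  then have "|UNIV :: omega1 set| =o |Field (cardSuc natLeq)|"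
    using card_of_ordIso by blast
  moreover have "|Field (cardSuc natLeq)| =o cardSuc natLeq"
    by (intro card_of_Field_ordIso cardSuc_Card_order natLeq_Card_order)
  ultimately show ?thesis
    by (rule ordIso_transitive)
qed

lemma uncountable_omega1:
  includes cardinal_syntax
  shows "uncountable (UNIV :: omega1 set)"
proof
  assume "countable (UNIV :: omega1 set)"
  then have "|UNIV :: omega1 set| \<le>o |UNIV :: nat set|"
    unfolding countable_def card_of_ordLeq[symmetric] by auto
  then have "|UNIV :: omega1 set| \<le>o natLeq"
    using card_of_nat ordLeq_ordIso_trans by blast
  then have "cardSuc natLeq \<le>o natLeq"
    using card_of_omega1 ordIso_ordLeq_trans ordIso_symmetric by blast
  then show False
    using cardSuc_greater[OF natLeq_Card_order] not_ordLess_ordLeq by blast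
qed


text \<open>The Banach space \<open>c\<^sub>0(I)\<close>, the index set being the universe of the type \<open>'i\<close>.\<close>

typedef 'i c0 = "{f :: 'i \<Rightarrow> real. \<forall>e>0. finite {i. e \<le> \<bar>f i\<bar>}}"
  morphisms apply_c0 Abs_c0
  by (rule exI[of _ "\<lambda>_. 0"]) auto

setup_lifting type_definition_c0

lemma c0_plus_aux:
  fixes f g :: "'i \<Rightarrow> real"
  assumes "\<forall>e>0. finite {i. e \<le> \<bar>f i\<bar>}" "\<forall>e>0. finite {i. e \<le> \<bar>g i\<bar>}" "e > 0"
  shows "finite {i. e \<le> \<bar>f i + g i\<bar>}"
proof (rule finite_subset)
  show "{i. e \<le> \<bar>f i + g i\<bar>} \<subseteq> {i. e/2 \<le> \<bar>f i\<bar>} \<union> {i. e/2 \<le> \<bar>g i\<bar>}"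
    by (auto simp: not_le)
  show "finite ({i. e/2 \<le> \<bar>f i\<bar>} \<union> {i. e/2 \<le> \<bar>g i\<bar>})"
    using assms(1)[rule_format, of "e/2"] assms(2)[rule_format, of "e/2"] assms(3)
    by (simp del: le_divide_eq_numeral1 divide_le_eq_numeral1)
qed

lemma c0_scale_aux:
  fixes f :: "'i \<Rightarrow> real"
  assumes "\<forall>e>0. finite {i. e \<le> \<bar>f i\<bar>}" "e > 0"
  shows "finite {i. e \<le> \<bar>r * f i\<bar>}"
proof (cases "r = 0")
  case True
  with assms(2) show ?thesis by (auto simp: not_le)
next
  case False
  then have "{i. e \<le> \<bar>r * f i\<bar>} = {i. e / \<bar>r\<bar> \<le> \<bar>f i\<bar>}"
    by (auto simp: abs_mult field_simps)
  moreover have "e / \<bar>r\<bar> > 0" using False assms(2) by simp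
  ultimately show ?thesis using assms(1) by simp
qed

instantiation c0 :: (type) real_vector
begin

lift_definition zero_c0 :: "'a c0" is "\<lambda>_. 0" by auto
lift_definition plus_c0 :: "'a c0 \<Rightarrow> 'a c0 \<Rightarrow> 'a c0" is "\<lambda>f g i. f i + g i"
  by (blast intro: c0_plus_aux)
lift_definition uminus_c0 :: "'a c0 \<Rightarrow> 'a c0" is "\<lambda>f i. - f i" by simp
lift_definition minus_c0 :: "'a c0 \<Rightarrow> 'a c0 \<Rightarrow> 'a c0" is "\<lambda>f g i. f i - g i"
  subgoal for f g using c0_plus_aux[of f "\<lambda>i. - g i"] by simp
  done
lift_definition scaleR_c0 :: "real \<Rightarrow> 'a c0 \<Rightarrow> 'a c0" is "\<lambda>r f i. r * f i"
  by (blast intro: c0_scale_aux)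

instance
  by standard (transfer; auto simp: algebra_simps)+

end

lemma bdd_above_c0: "bdd_above (range (\<lambda>i. \<bar>apply_c0 f i\<bar>))"
proof -
  have fin: "finite {i. 1 \<le> \<bar>apply_c0 f i\<bar>}"
    using apply_c0[of f] by simp
  show ?thesis
  proof (rule bdd_aboveI2)
    fix i
    show "\<bar>apply_c0 f i\<bar> \<le> 1 + (\<Sum>j\<in>{i. 1 \<le> \<bar>apply_c0 f i\<bar>}. \<bar>apply_c0 f j\<bar>)"
    proof (cases "1 \<le> \<bar>apply_c0 f i\<bar>")
      case True
      then have "\<bar>apply_c0 f i\<bar> \<le> (\<Sum>j\<in>{i. 1 \<le> \<bar>apply_c0 f i\<bar>}. \<bar>apply_c0 f j\<bar>)"
        using fin by (intro member_le_sum) auto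
      then show ?thesis by simp
    next
      case False
      moreover have "0 \<le> (\<Sum>j\<in>{i. 1 \<le> \<bar>apply_c0 f i\<bar>}. \<bar>apply_c0 f j\<bar>)"
        by (intro sum_nonneg) auto
      ultimately show ?thesis by linarith
    qed
  qed
qed

instantiation c0 :: (type) real_normed_vector
begin

definition norm_c0 :: "'a c0 \<Rightarrow> real"
  where "norm_c0 f = (SUP i. \<bar>apply_c0 f i\<bar>)"

definition dist_c0 :: "'a c0 \<Rightarrow> 'a c0 \<Rightarrow> real"
  where "dist_c0 f g = norm (f - g)"

definition sgn_c0 :: "'a c0 \<Rightarrow> 'a c0"
  where "sgn_c0 f = f /\<^sub>R norm f"

definition uniformity_c0 :: "('a c0 \<times> 'a c0) filter"
  where "uniformity_c0 = (INF e\<in>{0 <..}. principal {(x, y). dist x y < e})"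

definition open_c0 :: "'a c0 set \<Rightarrow> bool"
  where "open_c0 S = (\<forall>x\<in>S. \<forall>\<^sub>F (x', y) in uniformity. x' = x \<longrightarrow> y \<in> S)"

lemma apply_c0_le_norm: "\<bar>apply_c0 f i\<bar> \<le> norm f"
  unfolding norm_c0_def by (rule cSUP_upper[OF UNIV_I bdd_above_c0])

lemma norm_c0_le: "(\<And>i. \<bar>apply_c0 f i\<bar> \<le> B) \<Longrightarrow> norm f \<le> B"
  unfolding norm_c0_def by (rule cSUP_least) auto

instance
proof
  fix f g :: "'a c0" and a :: real
  show "norm f = 0 \<longleftrightarrow> f = 0"
  proof
    assume "norm f = 0"
    then have "apply_c0 f = apply_c0 0"
      using apply_c0_le_norm[of f] by (auto simp: zero_c0.rep_eq)
    then show "f = 0" by (simp add: apply_c0_inject)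
  qed (simp add: norm_c0_def zero_c0.rep_eq)
  show "norm (f + g) \<le> norm f + norm g"
    by (rule norm_c0_le)
      (smt (verit) apply_c0_le_norm plus_c0.rep_eq)
  have le: "norm (b *\<^sub>R h) \<le> \<bar>b\<bar> * norm h" for b and h :: "'a c0"
    by (rule norm_c0_le)
      (simp add: scaleR_c0.rep_eq abs_mult mult_left_mono apply_c0_le_norm)
  show "norm (a *\<^sub>R f) = \<bar>a\<bar> * norm f"
  proof (cases "a = 0")
    case True
    then show ?thesis by (simp add: norm_c0_def zero_c0.rep_eq)
  next
    case False
    have "norm f \<le> \<bar>inverse a\<bar> * norm (a *\<^sub>R f)"
      using le[of "inverse a" "a *\<^sub>R f"] False by simp
    then have "\<bar>a\<bar> * norm f \<le> norm (a *\<^sub>R f)"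
      using False by (simp add: field_simps)
    with le[of a f] show ?thesis by simp
  qed
qed (simp_all add: dist_c0_def sgn_c0_def uniformity_c0_def open_c0_def)

end

instance c0 :: (type) banach
proof
  fix f :: "nat \<Rightarrow> 'a c0"
  assume C: "Cauchy f"
  have ptw: "Cauchy (\<lambda>n. apply_c0 (f n) i)" for i
    unfolding Cauchy_def
  proof safe
    fix e :: real assume "e > 0"
    with C obtain N where N: "\<And>m n. m \<ge> N \<Longrightarrow> n \<ge> N \<Longrightarrow> dist (f m) (f n) < e"
      unfolding Cauchy_def by blast
    have "dist (apply_c0 (f m) i) (apply_c0 (f n) i) < e" if "m \<ge> N" "n \<ge> N" for m n
      using N[OF that] apply_c0_le_norm[of "f m - f n" i]
      by (simp add: dist_norm minus_c0.rep_eq)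
    then show "\<exists>N. \<forall>m\<ge>N. \<forall>n\<ge>N. dist (apply_c0 (f m) i) (apply_c0 (f n) i) < e"
      by blast
  qed
  then have "\<forall>i. \<exists>l. (\<lambda>n. apply_c0 (f n) i) \<longlonglongrightarrow> l"
    using Cauchy_convergent_iff convergent_def by blast
  then obtain g where g: "\<And>i. (\<lambda>n. apply_c0 (f n) i) \<longlonglongrightarrow> g i"
    by metis
  have unif: "\<exists>N. \<forall>n\<ge>N. \<forall>i. \<bar>apply_c0 (f n) i - g i\<bar> \<le> e" if "e > 0" for e
  proof -
    from C that obtain N where N: "\<And>m n. m \<ge> N \<Longrightarrow> n \<ge> N \<Longrightarrow> dist (f m) (f n) < e"
      unfolding Cauchy_def by blast
    have "\<bar>apply_c0 (f n) i - g i\<bar> \<le> e" if "n \<ge> N" for n i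
    proof (rule tendsto_upperbound)
      show "(\<lambda>m. \<bar>apply_c0 (f n) i - apply_c0 (f m) i\<bar>) \<longlonglongrightarrow> \<bar>apply_c0 (f n) i - g i\<bar>"
        by (intro tendsto_intros g)
      have "\<bar>apply_c0 (f n) i - apply_c0 (f m) i\<bar> \<le> e" if "m \<ge> N" for m
        using N[OF \<open>n \<ge> N\<close> that] apply_c0_le_norm[of "f n - f m" i]
        by (simp add: dist_norm minus_c0.rep_eq)
      then show "\<forall>\<^sub>F m in sequentially. \<bar>apply_c0 (f n) i - apply_c0 (f m) i\<bar> \<le> e"
        unfolding eventually_sequentially by blast
    qed simp
    then show ?thesis by blast
  qed
  have "finite {i. e \<le> \<bar>g i\<bar>}" if "e > 0" for e
  proof -
    from unif[of "e/2"] that obtain N where N: "\<And>i. \<bar>apply_c0 (f N) i - g i\<bar> \<le> e/2"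
      by auto
    have "{i. e \<le> \<bar>g i\<bar>} \<subseteq> {i. e/2 \<le> \<bar>apply_c0 (f N) i\<bar>}"
      using N by (smt (verit) Collect_mono field_sum_of_halves)
    moreover have "finite {i. e/2 \<le> \<bar>apply_c0 (f N) i\<bar>}"
      using apply_c0[of "f N"] half_gt_zero[OF that] by blast
    ultimately show ?thesis by (rule finite_subset)
  qed
  then have ag: "apply_c0 (Abs_c0 g) = g"
    by (simp add: Abs_c0_inverse)
  have "f \<longlonglongrightarrow> Abs_c0 g"
  proof (rule LIMSEQ_I)
    fix e :: real assume "e > 0"
    with unif[of "e/2"] obtain N where N: "\<And>n i. n \<ge> N \<Longrightarrow> \<bar>apply_c0 (f n) i - g i\<bar> \<le> e/2"
      by auto
    have "norm (f n - Abs_c0 g) < e" if "n \<ge> N" for n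
    proof -
      have "norm (f n - Abs_c0 g) \<le> e/2"
        by (rule norm_c0_le) (simp only: minus_c0.rep_eq ag N[OF that])
      with \<open>e > 0\<close> show ?thesis by simp
    qed
    then show "\<exists>N. \<forall>n\<ge>N. norm (f n - Abs_c0 g) < e" by blast
  qed
  then show "convergent f" by (rule convergentI)
qed


definition isomorphism_onto ::
    "('a::real_normed_vector \<Rightarrow> 'b::real_normed_vector) \<Rightarrow> 'b set \<Rightarrow> bool"
  where "isomorphism_onto T Y \<longleftrightarrow> linear T \<and> (\<exists>T'. homeomorphism UNIV Y T T')"

definition support_fun :: "('a::real_normed_vector \<Rightarrow>\<^sub>L real) \<Rightarrow> 'a set \<Rightarrow> real"
  where "support_fun x' C = (SUP x\<in>C. blinfun_apply x' x)"

text \<open>Set functions are total in HOL; only their values on \<open>\<Sigma>\<close> matter. As the order of the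
  sequence is arbitrary, the series below converge unconditionally.\<close>

definition ca :: "'w set set \<Rightarrow> ('w set \<Rightarrow> real) set"
  where "ca \<Sigma> = {\<nu>. \<nu> {} = 0 \<and>
    (\<forall>A :: nat \<Rightarrow> 'w set. range A \<subseteq> \<Sigma> \<longrightarrow> disjoint_family A \<longrightarrow>
       (\<Union>n. A n) \<in> \<Sigma> \<longrightarrow> (\<lambda>n. \<nu> (A n)) sums \<nu> (\<Union>n. A n))}"

definition multimeasure :: "'w set set \<Rightarrow> ('w set \<Rightarrow> 'a::real_normed_vector set) \<Rightarrow> bool"
  where "multimeasure \<Sigma> M \<longleftrightarrow>
    (\<forall>A\<in>\<Sigma>. bounded (M A) \<and> M A \<noteq> {}) \<and>
    (\<forall>x'. (\<lambda>A. support_fun x' (M A)) \<in> ca \<Sigma>)"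

definition control_measure ::
    "'w set \<Rightarrow> 'w set set \<Rightarrow> ('w set \<Rightarrow> 'a::real_normed_vector set) \<Rightarrow> 'w measure \<Rightarrow> bool"
  where "control_measure \<Omega> \<Sigma> M \<mu> \<longleftrightarrow>
    space \<mu> = \<Omega> \<and> sets \<mu> = \<Sigma> \<and> finite_measure \<mu> \<and>
    (\<forall>A\<in>\<Sigma>. emeasure \<mu> A = 0 \<longrightarrow> M A = {0})"

end

theory Submission
  imports Defs
begin

text \<open>Each set function \<open>A \<mapsto> s(x\<^sup>*, M(A))\<close> has a finite total variation measure. If every disjoint family of
  sets that are non-null for some of these variations is countable, then countably many variations
  already determine the common null sets (as in the Halmos--Savage theorem), and a weighted sum of
  them is a control measure. Otherwise there are \<open>\<omega>\<^sub>1\<close> disjoint sets \<open>B\<^sub>i\<close> and vectors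
  \<open>x\<^sub>i \<in> M(B\<^sub>i)\<close> whose norms are bounded away from 0. Since the range of \<open>M\<close> is bounded and
  \<open>s(x\<^sup>*, M(\<cdot>))\<close> is additive, the sums \<open>\<Sum>|x\<^sup>*(x\<^sub>i)|\<close> are bounded by \<open>C \<parallel>x\<^sup>*\<parallel>\<close>, and Rosenthal's
  disjointification argument extracts a subfamily that is equivalent to the unit vectors of
  \<open>c\<^sub>0(\<omega>\<^sub>1)\<close>.\<close>

section \<open>Norming functionals and uniform boundedness\<close>

definition sublinear :: "('a::real_vector \<Rightarrow> real) \<Rightarrow> bool"
  where "sublinear p \<longleftrightarrow>
    (\<forall>x y. p (x + y) \<le> p x + p y) \<and> (\<forall>x. \<forall>t\<ge>0. p (t *\<^sub>R x) = t * p x)"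

lemma sublinear_add: "sublinear p \<Longrightarrow> p (x + y) \<le> p x + p y"
  and sublinear_scaleR: "sublinear p \<Longrightarrow> 0 \<le> t \<Longrightarrow> p (t *\<^sub>R x) = t * p x"
  by (simp_all add: sublinear_def)

lemma sublinear_zero: "sublinear p \<Longrightarrow> p 0 = 0"
  using sublinear_scaleR[of p 0 0] by simp

lemma sublinear_norm: "sublinear (norm :: 'a::real_normed_vector \<Rightarrow> real)"
  by (simp add: sublinear_def norm_triangle_ineq)

lemma sublinear_minus_le: "sublinear p \<Longrightarrow> - p (- x) \<le> p x"
  using sublinear_add[of p x "- x"] sublinear_zero[of p] by simp

text \<open>The largest sublinear \<open>r \<le> p\<close> with \<open>r (- y) \<le> - p y\<close>. If \<open>p\<close> is minimal, then \<open>shrink p y = p\<close>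
  makes \<open>p\<close> additive, and a minimal \<open>p \<le> shrink norm y\<close> is a functional that norms \<open>y\<close>. This
  proves Hahn--Banach without extending functionals from subspaces.\<close>

definition shrink :: "('a::real_vector \<Rightarrow> real) \<Rightarrow> 'a \<Rightarrow> 'a \<Rightarrow> real"
  where "shrink p y x = (INF t\<in>{0..}. p (x + t *\<^sub>R y) - t * p y)"

lemma shrink_le:
  assumes "sublinear p" "0 \<le> t"
  shows "shrink p y x \<le> p (x + t *\<^sub>R y) - t * p y"
proof -
  \<comment> \<open>This lower bound makes the infimum genuine; \<open>INF\<close> of a set of reals
    without lower bound would be unspecified.\<close>
  have "- p (- x) \<le> p (x + s *\<^sub>R y) - s * p y" if "0 \<le> s" for s
    using sublinear_add[OF assms(1), of "x + s *\<^sub>R y" "- x"]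
      sublinear_scaleR[OF assms(1) that, of y] by simp
  then have "bdd_below ((\<lambda>t. p (x + t *\<^sub>R y) - t * p y) ` {0..})"
    by (intro bdd_belowI2) auto
  then show ?thesis
    unfolding shrink_def using assms(2) by (intro cINF_lower) auto
qed

lemma shrink_greatest:
  "(\<And>t. 0 \<le> t \<Longrightarrow> B \<le> p (x + t *\<^sub>R y) - t * p y) \<Longrightarrow> B \<le> shrink p y x"
  unfolding shrink_def by (intro cINF_greatest) auto

text \<open>Subadditivity holds because parameters \<open>s\<close> for \<open>u\<close> and
  \<open>t\<close> for \<open>v\<close> add up to the parameter \<open>s + t\<close> for
  \<open>u + v\<close>. Homogeneity comes from replacing \<open>t\<close> by \<open>t / c\<close>,
  once for a positive scalar and once for its inverse.\<close>

lemma sublinear_shrink: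
  assumes p: "sublinear p"
  shows "sublinear (shrink p y)"
  unfolding sublinear_def
proof safe
  fix u v
  have "shrink p y (u + v) - (p (u + s *\<^sub>R y) - s * p y) \<le> shrink p y v" if s: "0 \<le> s" for s
  proof (rule shrink_greatest)
    fix t :: real assume t: "0 \<le> t"
    have "shrink p y (u + v) \<le> p ((u + v) + (s + t) *\<^sub>R y) - (s + t) * p y"
      using s t by (intro shrink_le p) auto
    also have "(u + v) + (s + t) *\<^sub>R y = (u + s *\<^sub>R y) + (v + t *\<^sub>R y)"
      by (simp add: algebra_simps)
    finally show "shrink p y (u + v) - (p (u + s *\<^sub>R y) - s * p y) \<le> p (v + t *\<^sub>R y) - t * p y"
      using sublinear_add[OF p, of "u + s *\<^sub>R y" "v + t *\<^sub>R y"] by (simp add: algebra_simps)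
  qed
  then have "shrink p y (u + v) - shrink p y v \<le> shrink p y u"
    by (intro shrink_greatest) (simp add: algebra_simps)
  then show "shrink p y (u + v) \<le> shrink p y u + shrink p y v"
    by simp
next
  fix u and r :: real assume r: "0 \<le> r"
  have le: "c * shrink p y v \<le> shrink p y (c *\<^sub>R v)" if c: "0 < c" for c v
  proof (rule shrink_greatest)
    fix t :: real assume t: "0 \<le> t"
    have "c *\<^sub>R v + t *\<^sub>R y = c *\<^sub>R (v + (t / c) *\<^sub>R y)"
      using c by (simp add: algebra_simps)
    then have "p (c *\<^sub>R v + t *\<^sub>R y) = c * p (v + (t / c) *\<^sub>R y)"
      using c sublinear_scaleR[OF p, of c] by simp
    moreover have "c * shrink p y v \<le> c * (p (v + (t / c) *\<^sub>R y) - (t / c) * p y)"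
      using c t by (intro mult_left_mono shrink_le p) auto
    ultimately show "c * shrink p y v \<le> p (c *\<^sub>R v + t *\<^sub>R y) - t * p y"
      using c by (simp add: algebra_simps)
  qed
  show "shrink p y (r *\<^sub>R u) = r * shrink p y u"
  proof (cases "r = 0")
    case True
    have "shrink p y 0 = 0"
    proof (rule antisym)
      show "shrink p y 0 \<le> 0"
        using shrink_le[OF p, of 0 y 0] sublinear_zero[OF p] by simp
      show "0 \<le> shrink p y 0"
        by (rule shrink_greatest) (simp add: sublinear_scaleR[OF p])
    qed
    with True show ?thesis by simp
  next
    case False
    with r have r: "0 < r" by simp
    have "inverse r * shrink p y (r *\<^sub>R u) \<le> shrink p y u"
      using le[of "inverse r" "r *\<^sub>R u"] r by simp
    then have "shrink p y (r *\<^sub>R u) \<le> r * shrink p y u"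
      using r by (simp add: field_simps)
    with le[OF r] show ?thesis by (intro antisym) auto
  qed
qed

text \<open>Zorn's lemma for the reversed pointwise order. A nonempty chain has its pointwise
  infimum as lower bound, which is finite since every member \<open>f\<close> satisfies
  \<open>- q (- x) \<le> f x\<close>.\<close>

lemma ex_minimal_sublinear:
  fixes q :: "'a::real_vector \<Rightarrow> real"
  assumes q: "sublinear q"
  obtains p where "sublinear p" "p \<le> q" "\<And>r. sublinear r \<Longrightarrow> r \<le> p \<Longrightarrow> r = p"
proof -
  define S where "S = {p. sublinear p \<and> p \<le> q}"
  have "\<exists>m\<in>S. \<forall>a\<in>S. a \<le> m \<longrightarrow> a = m"
  proof (rule predicate_Zorn)
    show "partial_order_on S (relation_of (\<lambda>a b. b \<le> a) S)"
      by (auto simp: partial_order_on_def preorder_on_def refl_on_def trans_def antisym_def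
          relation_of_def)
    fix C assume "C \<in> Chains (relation_of (\<lambda>a b. b \<le> a) S)"
    then have CS: "C \<subseteq> S" and chain: "\<And>f g. f \<in> C \<Longrightarrow> g \<in> C \<Longrightarrow> f \<le> g \<or> g \<le> f"
      by (auto simp: Chains_def relation_of_def)
    show "\<exists>u\<in>S. \<forall>a\<in>C. u \<le> a"
    proof (cases "C = {}")
      case True
      with q show ?thesis by (auto simp: S_def)
    next
      case False
      define u where "u = (\<lambda>x. INF f\<in>C. f x)"
      have C: "sublinear f" "f \<le> q" if "f \<in> C" for f
        using CS that by (auto simp: S_def)
      have "- q (- x) \<le> f x" if "f \<in> C" for f x
        using sublinear_minus_le[OF C(1)[OF that], of x] le_funD[OF C(2)[OF that], of "- x"]
        by linarith
      then have bdd: "bdd_below ((\<lambda>f. f x) ` C)" for x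
        by (intro bdd_belowI2) auto
      have u_le: "u x \<le> f x" if "f \<in> C" for f x
        unfolding u_def by (rule cINF_lower[OF bdd that])
      have u_ge: "B \<le> u x" if "\<And>f. f \<in> C \<Longrightarrow> B \<le> f x" for B x
        unfolding u_def by (rule cINF_greatest[OF False that])
      have "sublinear u"
        unfolding sublinear_def
      proof safe
        fix x y
        have "u (x + y) - f x \<le> g y" if fg: "f \<in> C" "g \<in> C" for f g
        proof -
          \<comment> \<open>The smaller of \<open>f\<close> and \<open>g\<close> serves at both
            points; this is why the infimum of a chain stays subadditive.\<close>
          obtain h where h: "h \<in> C" "h \<le> f" "h \<le> g"
            using chain[OF fg] fg by auto
          have "u (x + y) \<le> h (x + y)"
            by (rule u_le[OF h(1)])
          also have "\<dots> \<le> h x + h y"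
            by (rule sublinear_add[OF C(1)[OF h(1)]])
          finally show ?thesis
            using le_funD[OF h(2), of x] le_funD[OF h(3), of y] by linarith
        qed
        then have "u (x + y) - f x \<le> u y" if "f \<in> C" for f
          using that by (intro u_ge) auto
        then have "u (x + y) - u y \<le> u x"
          by (intro u_ge) (simp add: algebra_simps)
        then show "u (x + y) \<le> u x + u y" by simp
      next
        fix x and t :: real assume t: "0 \<le> t"
        have le: "c * u y \<le> u (c *\<^sub>R y)" if "0 \<le> c" for c y
          using that by (intro u_ge) (simp add: C sublinear_scaleR mult_left_mono u_le)
        show "u (t *\<^sub>R x) = t * u x"
        proof (cases "t = 0")
          case True
          then have "u (t *\<^sub>R x) = (INF f\<in>C. 0)"
            unfolding u_def by (intro INF_cong) (auto simp: C sublinear_zero)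
          with True False show ?thesis by simp
        next
          case False
          with t have "inverse t * u (t *\<^sub>R x) \<le> u x"
            using le[of "inverse t" "t *\<^sub>R x"] by simp
          then have "u (t *\<^sub>R x) \<le> t * u x"
            using t False by (simp add: field_simps)
          with le[OF t] show ?thesis by (intro antisym) auto
        qed
      qed
      moreover have "u \<le> q"
        using False C(2) u_le by (metis ex_in_conv le_funD le_funI order_trans)
      ultimately show ?thesis
        using u_le by (auto simp: S_def le_fun_def)
    qed
  qed
  then obtain p where p: "sublinear p" "p \<le> q" and min: "\<And>r. r \<in> S \<Longrightarrow> r \<le> p \<Longrightarrow> r = p"
    by (auto simp: S_def)
  show ?thesis
    using p min order_trans[of _ p q] by (intro that[of p]) (auto simp: S_def)
qed

lemma linear_minimal_sublinear:
  fixes p :: "'a::real_vector \<Rightarrow> real"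
  assumes p: "sublinear p" and min: "\<And>r. sublinear r \<Longrightarrow> r \<le> p \<Longrightarrow> r = p"
  shows "linear p"
proof -
  \<comment> \<open>The parameter \<open>t = 0\<close> gives \<open>shrink p y \<le> p\<close>, so
    minimality forces equality; \<open>t = 1\<close> then yields
    \<open>p x + p y \<le> p (x + y)\<close>.\<close>
  have "shrink p y = p" for y
    using shrink_le[OF p order_refl, of y] by (intro min sublinear_shrink p le_funI) simp
  then have add: "p (x + y) = p x + p y" for x y
    using shrink_le[OF p zero_le_one, of y x] sublinear_add[OF p, of x y] by simp
  have neg: "p (- x) = - p x" for x
    using add[of x "- x"] sublinear_zero[OF p] by simp
  have "p (r *\<^sub>R x) = r * p x" for r x
  proof (cases "0 \<le> r")
    case False
    then show ?thesis
      using neg[of "r *\<^sub>R x"] sublinear_scaleR[OF p, of "- r" x] by simp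
  qed (rule sublinear_scaleR[OF p])
  with add show ?thesis
    by (intro linearI) auto
qed

theorem norming_functional:
  fixes y :: "'a::real_normed_vector"
  obtains f :: "'a \<Rightarrow>\<^sub>L real" where "norm f \<le> 1" "blinfun_apply f y = norm y"
proof -
  obtain p where p: "sublinear p" "p \<le> shrink norm y"
    and min: "\<And>r. sublinear r \<Longrightarrow> r \<le> p \<Longrightarrow> r = p"
    using ex_minimal_sublinear[OF sublinear_shrink[OF sublinear_norm, of y]] by blast
  have lin: "linear p"
    using p(1) min by (rule linear_minimal_sublinear)
  have le: "p x \<le> norm x" for x
    using le_funD[OF p(2), of x] shrink_le[OF sublinear_norm order_refl, of y x] by simp
  \<comment> \<open>At the point \<open>- y\<close>, the parameter \<open>t = 1\<close> bounds the
    infimum by \<open>norm 0 - norm y\<close>; linearity turns this into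
    \<open>norm y \<le> p y\<close>.\<close>
  have "p (- y) \<le> - norm y"
    using le_funD[OF p(2), of "- y"] shrink_le[OF sublinear_norm zero_le_one, of y "- y"] by simp
  with le[of y] have py: "p y = norm y"
    by (simp add: linear_neg[OF lin])
  have abs: "norm (p x) \<le> norm x" for x
    using le[of x] le[of "- x"] by (simp add: linear_neg[OF lin] abs_le_iff)
  have bl: "bounded_linear p"
    using abs by (intro bounded_linear_intro[where K = 1] linear_add linear_cmul lin) auto
  show ?thesis
  proof
    show "norm (Blinfun p) \<le> 1"
      using abs by (intro norm_blinfun_bound) (simp_all add: bounded_linear_Blinfun_apply bl)
    show "blinfun_apply (Blinfun p) y = norm y"
      by (simp add: bounded_linear_Blinfun_apply bl py)
  qed
qed

section \<open>Banach--Steinhaus and weakly bounded sets\<close>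

theorem uniform_boundedness:
  fixes F :: "('a::banach \<Rightarrow>\<^sub>L 'b::real_normed_vector) set"
  assumes "\<And>x. bounded ((\<lambda>f. blinfun_apply f x) ` F)"
  shows "bounded F"
proof -
  define D where "D n = {x. \<forall>f\<in>F. norm (blinfun_apply f x) \<le> real n}" for n
  have clD: "closed (D n)" for n
    unfolding D_def Ball_def
    by (intro closed_Collect_all closed_Collect_imp open_Collect_const closed_Collect_le
        continuous_intros)
  have "\<exists>n. x \<in> D n" for x
  proof -
    obtain b where "\<And>f. f \<in> F \<Longrightarrow> norm (blinfun_apply f x) \<le> b"
      using assms[of x] by (auto simp: bounded_iff)
    then show ?thesis
      using real_arch_simple[of b] unfolding D_def by (blast intro: order_trans)
  qed
  \<comment> \<open>Baire: closed sets that cover a complete space cannot all have empty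
    interior.\<close>
  then have "\<Union>(range D) = UNIV" by auto
  moreover have "complete (UNIV :: 'a set)"
    using Cauchy_convergent by (auto simp: complete_def convergent_def)
  ultimately obtain n where "interior (D n) \<noteq> {}"
    using Met_TC.metric_Baire_category_alt[of "range D"] clD by simp blast
  then obtain z r where r: "0 < r" and ball: "cball z r \<subseteq> D n"
    by (metis ex_in_conv mem_interior_cball)
  \<comment> \<open>A vector \<open>w\<close> of norm \<open>r\<close> is the difference of
    \<open>z + w\<close> and \<open>z\<close>, both in \<open>D n\<close>; hence the factor
    2.\<close>
  have "norm f \<le> 2 * real n / r" if "f \<in> F" for f
  proof (rule norm_blinfun_bound)
    fix x
    show "norm (blinfun_apply f x) \<le> 2 * real n / r * norm x"
    proof (cases "x = 0")
      case False
      define w where "w = (r / norm x) *\<^sub>R x"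
      have "norm w = r"
        using False r by (simp add: w_def)
      then have "z + w \<in> D n" "z \<in> D n"
        using ball r by (auto simp: dist_norm)
      then have "norm (blinfun_apply f (z + w)) \<le> n" "norm (blinfun_apply f z) \<le> n"
        using that by (auto simp: D_def)
      then have "norm (blinfun_apply f w) \<le> 2 * n"
        using norm_triangle_ineq4[of "blinfun_apply f (z + w)" "blinfun_apply f z"]
        by (simp add: blinfun.add_right)
      then show ?thesis
        using False r by (simp add: w_def blinfun.scaleR_right field_simps)
    qed simp
  qed (use r in simp)
  then show ?thesis
    unfolding bounded_iff by blast
qed

text \<open>Points act as evaluations on the dual, which is complete even if the space is not, so
  uniform boundedness applies there. Norming functionals carry the bound back from
  \<open>ev x\<close> to \<open>x\<close>.\<close>

theorem bounded_of_weakly_bounded: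
  fixes S :: "'a::real_normed_vector set"
  assumes "\<And>f :: 'a \<Rightarrow>\<^sub>L real. bounded (blinfun_apply f ` S)"
  shows "bounded S"
proof -
  define ev where "ev x = Blinfun (\<lambda>f :: 'a \<Rightarrow>\<^sub>L real. blinfun_apply f x)" for x
  have ev: "blinfun_apply (ev x) f = blinfun_apply f x" for x f
    unfolding ev_def
    by (simp add: bounded_linear_Blinfun_apply blinfun.bounded_linear_left)
  have "bounded (ev ` S)"
    using assms by (intro uniform_boundedness) (simp add: image_image ev)
  then obtain K where K: "\<And>x. x \<in> S \<Longrightarrow> norm (ev x) \<le> K"
    by (auto simp: bounded_iff)
  have "norm x \<le> K" if "x \<in> S" for x
  proof -
    obtain f :: "'a \<Rightarrow>\<^sub>L real" where f: "norm f \<le> 1" "blinfun_apply f x = norm x"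
      using norming_functional by blast
    have "norm x \<le> norm (ev x) * norm f"
      using norm_blinfun[of "ev x" f] f by (simp add: ev)
    also have "\<dots> \<le> norm (ev x) * 1"
      using f(1) by (intro mult_left_mono) auto
    finally show ?thesis using K[OF that] by simp
  qed
  then show ?thesis
    unfolding bounded_iff by blast
qed

section \<open>Copies of \<open>c\<^sub>0(I)\<close>\<close>

text \<open>Split the index set into copies \<open>\<pi> ({k} \<times> UNIV)\<close> of itself. If every copy contains a row \<open>g k\<close>
  whose sum over that copy exceeds \<open>\<delta>\<close>, then on the set of these rows the row sums have dropped
  by \<open>\<delta>\<close>, as the \<open>k\<close>-th copy meets that set only in \<open>g k\<close>.\<close>

lemma rosenthal_disjointification:
  fixes a :: "'i \<Rightarrow> 'i \<Rightarrow> real" and \<pi> :: "'i \<times> 'i \<Rightarrow> 'i"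
  assumes \<pi>: "inj \<pi>"
    and bound: "\<And>i F. finite F \<Longrightarrow> i \<notin> F \<Longrightarrow> (\<Sum>j\<in>F. a i j) \<le> real n * \<delta>"
    and \<delta>: "0 \<le> \<delta>"
  shows "\<exists>h :: 'i \<Rightarrow> 'i. inj h \<and> (\<forall>i F. finite F \<longrightarrow> i \<notin> F \<longrightarrow> (\<Sum>j\<in>F. a (h i) (h j)) \<le> \<delta>)"
  using bound
proof (induction n arbitrary: a)
  case 0
  have "sum (a i) F \<le> \<delta>" if "finite F" "i \<notin> F" for i F
    using 0[OF that] \<delta> by simp
  then show ?case
    by (auto intro!: exI[of _ id])
next
  case (Suc n)
  show ?case
  proof (cases "\<exists>k. \<forall>i F. finite F \<longrightarrow> i \<notin> F \<longrightarrow> (\<Sum>j\<in>F. a (\<pi> (k, i)) (\<pi> (k, j))) \<le> \<delta>")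
    case True
    then obtain k where
      "\<forall>i F. finite F \<longrightarrow> i \<notin> F \<longrightarrow> (\<Sum>j\<in>F. a (\<pi> (k, i)) (\<pi> (k, j))) \<le> \<delta>" ..
    moreover have "inj (\<lambda>i. \<pi> (k, i))"
      by (auto simp: inj_on_def inj_eq[OF \<pi>])
    ultimately show ?thesis by blast
  next
    case False
    then have "\<exists>i F. finite F \<and> i \<notin> F \<and> \<delta> < (\<Sum>j\<in>F. a (\<pi> (k, i)) (\<pi> (k, j)))" for k
      by (simp add: not_le)
    then obtain i :: "'i \<Rightarrow> 'i" and F :: "'i \<Rightarrow> 'i set" where iF: "\<And>k. finite (F k)" "\<And>k. i k \<notin> F k"
      "\<And>k. \<delta> < (\<Sum>j\<in>F k. a (\<pi> (k, i k)) (\<pi> (k, j)))"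
      by metis
    define g where "g k = \<pi> (k, i k)" for k
    have g: "inj g"
      by (auto simp: g_def inj_on_def inj_eq[OF \<pi>])
    have "(\<Sum>m\<in>G. a (g k) (g m)) \<le> real n * \<delta>" if G: "finite G" "k \<notin> G" for k G
    proof -
      let ?H = "(\<lambda>j. \<pi> (k, j)) ` F k"
      have inj: "inj_on (\<lambda>j. \<pi> (k, j)) (F k)"
        by (auto simp: inj_on_def inj_eq[OF \<pi>])
      have "(\<Sum>m\<in>G. a (g k) (g m)) + (\<Sum>j\<in>F k. a (g k) (\<pi> (k, j)))
          = sum (a (g k)) (g ` G) + sum (a (g k)) ?H"
        using inj_on_subset[OF g] by (simp add: sum.reindex[OF inj] sum.reindex[of g G])
      also have "\<dots> = sum (a (g k)) (g ` G \<union> ?H)"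
        using G iF(1)[of k]
        by (intro sum.union_disjoint[symmetric]) (auto simp: g_def inj_eq[OF \<pi>])
      \<comment> \<open>The assumed bound concerns sums that omit the diagonal:
        \<open>k \<notin> G\<close> and \<open>i k \<notin> F k\<close> keep \<open>g k\<close> out
        of the columns.\<close>
      also have "\<dots> \<le> real (Suc n) * \<delta>"
        using G iF(1,2)[of k] by (intro Suc.prems) (auto simp: g_def inj_eq[OF \<pi>])
      finally show ?thesis
        using iF(3)[of k] by (simp add: g_def algebra_simps)
    qed
    then obtain h :: "'i \<Rightarrow> 'i" where
      "inj h" "\<forall>i F. finite F \<longrightarrow> i \<notin> F \<longrightarrow> (\<Sum>j\<in>F. a (g (h i)) (g (h j))) \<le> \<delta>"
      using Suc.IH[of "\<lambda>i j. a (g i) (g j)"] by blast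
    then show ?thesis
      using inj_compose[OF g, of h] by (intro exI[of _ "\<lambda>i. g (h i)"]) (simp add: o_def)
  qed
qed

text \<open>The upper estimate makes the series with coefficients in \<open>c0\<close> converge
  along the finite subsets. In the limit both estimates carry over to the sum \<open>T f\<close>, so
  \<open>T\<close> is bounded and bounded below, which gives a closed range and a continuous
  inverse.\<close>

lemma c0_embedding:
  fixes x :: "'i \<Rightarrow> 'a::banach"
  assumes upper: "\<And>F a B. finite F \<Longrightarrow> (\<And>i. i \<in> F \<Longrightarrow> \<bar>a i\<bar> \<le> B) \<Longrightarrow> 0 \<le> B \<Longrightarrow>
      norm (\<Sum>i\<in>F. a i *\<^sub>R x i) \<le> C * B"
    and lower: "\<And>F a k. finite F \<Longrightarrow> k \<in> F \<Longrightarrow> c * \<bar>a k\<bar> \<le> norm (\<Sum>i\<in>F. a i *\<^sub>R x i)"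
    and c: "0 < c"
  shows "\<exists>Y (T :: 'i c0 \<Rightarrow> 'a). subspace Y \<and> closed Y \<and> isomorphism_onto T Y"
proof -
  have summable: "(\<lambda>i. apply_c0 f i *\<^sub>R x i) summable_on UNIV" for f :: "'i c0"
  proof -
    let ?S = "\<lambda>F. \<Sum>i\<in>F. apply_c0 f i *\<^sub>R x i"
    have "cauchy_filter (filtermap ?S (finite_subsets_at_top UNIV))"
      unfolding cauchy_filter_metric_filtermap
    proof safe
      fix e :: real assume e: "0 < e"
      \<comment> \<open>The denominator uses \<open>\<bar>C\<bar> + 1\<close> because
        \<open>C\<close> may be 0 or negative. Finite sums over sets containing \<open>F0\<close>
        then lie within \<open>e / 4\<close> of the sum over \<open>F0\<close>.\<close>
      define d where "d = e / (4 * (\<bar>C\<bar> + 1))"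
      have d: "0 < d" using e by (simp add: d_def)
      define F0 where "F0 = {i. d \<le> \<bar>apply_c0 f i\<bar>}"
      have F0: "finite F0"
        using apply_c0[of f] d by (simp add: F0_def)
      have "C * d \<le> (\<bar>C\<bar> + 1) * d"
        using d by (intro mult_right_mono) auto
      also have "\<dots> = e / 4"
        using abs_ge_zero[of C] by (simp add: d_def field_simps)
      finally have Cd: "C * d \<le> e / 4" .
      have near: "dist (?S F) (?S F0) \<le> e / 4" if F: "finite F" "F0 \<subseteq> F" for F
      proof -
        have "?S F - ?S F0 = ?S (F - F0)"
          using F by (simp add: sum_diff)
        also have "norm \<dots> \<le> C * d"
          using F d by (intro upper) (auto simp: F0_def)
        finally show ?thesis
          using Cd by (simp add: dist_norm)
      qed
      have "dist (?S F) (?S G) < e" if "finite F" "F0 \<subseteq> F" "finite G" "F0 \<subseteq> G" for F G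
        using near[OF that(1,2)] near[OF that(3,4)] dist_triangle2[of "?S F" "?S G" "?S F0"] e
        by linarith
      moreover have "\<forall>\<^sub>F F in finite_subsets_at_top UNIV. finite F \<and> F0 \<subseteq> F"
        using F0 by (auto simp: eventually_finite_subsets_at_top)
      ultimately show "\<exists>P. eventually P (finite_subsets_at_top UNIV) \<and>
          (\<forall>F G. P F \<and> P G \<longrightarrow> dist (?S F) (?S G) < e)"
        by (intro exI[of _ "\<lambda>F. finite F \<and> F0 \<subseteq> F"]) auto
    qed
    moreover have "complete (UNIV :: 'a set)"
      using Cauchy_convergent by (auto simp: complete_def convergent_def)
    ultimately show ?thesis
      using complete_uniform[of "UNIV :: 'a set"]
      by (force simp: summable_on_def has_sum_def filterlim_def)
  qed
  define T where "T f = (\<Sum>\<^sub>\<infinity>i. apply_c0 f i *\<^sub>R x i)" for f :: "'i c0"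
  have lim: "((\<lambda>F. \<Sum>i\<in>F. apply_c0 f i *\<^sub>R x i) \<longlongrightarrow> T f) (finite_subsets_at_top UNIV)" for f
    using summable[of f] unfolding T_def summable_iff_has_sum_infsum has_sum_def .
  have T_le: "norm (T f) \<le> norm f * C" for f
  proof (rule tendsto_upperbound[OF tendsto_norm[OF lim]])
    have "norm (\<Sum>i\<in>F. apply_c0 f i *\<^sub>R x i) \<le> norm f * C" if "finite F" for F
      using upper[OF that, of "apply_c0 f" "norm f"] apply_c0_le_norm[of f]
      by (simp add: mult.commute)
    then show "\<forall>\<^sub>F F in finite_subsets_at_top UNIV.
        norm (\<Sum>i\<in>F. apply_c0 f i *\<^sub>R x i) \<le> norm f * C"
      by (auto simp: eventually_finite_subsets_at_top)
  qed simp
  have T_ge: "c * norm f \<le> norm (T f)" for f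
  proof -
    \<comment> \<open>The lower estimate speaks of finite sets containing \<open>k\<close>, and
      eventually all finite sets do.\<close>
    have "c * \<bar>apply_c0 f k\<bar> \<le> norm (T f)" for k
    proof (rule tendsto_lowerbound[OF tendsto_norm[OF lim]])
      show "\<forall>\<^sub>F F in finite_subsets_at_top UNIV.
          c * \<bar>apply_c0 f k\<bar> \<le> norm (\<Sum>i\<in>F. apply_c0 f i *\<^sub>R x i)"
        unfolding eventually_finite_subsets_at_top
        using lower[where k = k and a = "apply_c0 f"] by (intro exI[of _ "{k}"]) auto
    qed simp
    then have "norm f \<le> norm (T f) / c"
      using c by (intro norm_c0_le) (simp add: field_simps)
    then show ?thesis
      using c by (simp add: field_simps)
  qed
  have add: "T (f + g) = T f + T g" for f g
    unfolding T_def plus_c0.rep_eq scaleR_add_left by (intro infsum_add summable)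
  have scale: "T (r *\<^sub>R f) = r *\<^sub>R T f" for r f
    unfolding T_def scaleR_c0.rep_eq by (simp add: infsum_scaleR_right flip: scaleR_scaleR)
  have lin: "linear T"
    by (intro linearI add scale)
  have bl: "bounded_linear T"
    by (rule bounded_linear_intro[OF add scale T_le])
  have "complete (UNIV :: 'i c0 set)"
    using Cauchy_convergent by (auto simp: complete_def convergent_def)
  then have "closed (range T)"
    using complete_isometric_image[OF c subspace_UNIV bl] T_ge complete_imp_closed by auto
  moreover have "subspace (range T)"
    by (intro linear_subspace_image lin subspace_UNIV)
  moreover have "isomorphism_onto T (range T)"
  proof -
    have inj: "inj T"
      unfolding linear_injective_0[OF lin] using T_ge c
      by (metis mult_le_0_iff norm_le_zero_iff norm_zero not_less)
    have dist: "dist f g \<le> inverse c * dist (T f) (T g)" for f g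
      using T_ge[of "f - g"] c by (simp add: dist_norm linear_diff[OF lin] field_simps)
    have "continuous_on (range T) (inv T)"
    proof (rule continuous_on_iff[THEN iffD2], intro ballI allI impI)
      fix u and e :: real assume "u \<in> range T" "0 < e"
      then obtain f where u: "u = T f" by blast
      have "dist (inv T v) (inv T u) < e" if "v \<in> range T" "dist v u < c * e" for v
      proof -
        from that(1) obtain g where v: "v = T g" by blast
        have "inverse c * dist (T g) (T f) < e"
          using that(2) c by (simp add: v u field_simps)
        with dist[of g f] show ?thesis by (simp add: u v inv_f_f[OF inj])
      qed
      moreover have "0 < c * e"
        using c \<open>0 < e\<close> by simp
      ultimately show "\<exists>d>0. \<forall>v\<in>range T. dist v u < d \<longrightarrow> dist (inv T v) (inv T u) < e"
        by blast
    qed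
    then have "homeomorphism UNIV (range T) T (inv T)"
      using inj by (simp add: homeomorphism_def linear_continuous_on[OF bl])
    with lin show ?thesis
      unfolding isomorphism_onto_def by blast
  qed
  ultimately show ?thesis by blast
qed

text \<open>Rosenthal's argument is applied to the matrix of norming functionals of the
  \<open>x i\<close> at the \<open>x j\<close>: its diagonal entries are at least
  \<open>\<epsilon>\<close>, and the off-diagonal row sums can be pushed down to
  \<open>\<epsilon> / 2\<close>. The upper estimate tests a sum with its own norming functional, the
  lower one with that of the vector with the largest coefficient.\<close>

theorem c0_copy_of_weakly_unconditionally_bounded:
  fixes x :: "'i \<Rightarrow> 'a::banach"
  assumes inf: "infinite (UNIV :: 'i set)"
    and wub: "\<And>(f :: 'a \<Rightarrow>\<^sub>L real) F. finite F \<Longrightarrow> (\<Sum>i\<in>F. \<bar>blinfun_apply f (x i)\<bar>) \<le> C * norm f"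
    and \<epsilon>: "0 < \<epsilon>" "\<And>i. \<epsilon> \<le> norm (x i)"
  shows "\<exists>Y (T :: 'i c0 \<Rightarrow> 'a). subspace Y \<and> closed Y \<and> isomorphism_onto T Y"
proof -
  have "\<exists>f :: 'a \<Rightarrow>\<^sub>L real. norm f \<le> 1 \<and> blinfun_apply f y = norm y" for y
    using norming_functional[of y] by blast
  then obtain \<phi> :: "'a \<Rightarrow> 'a \<Rightarrow>\<^sub>L real"
    where \<phi>: "\<And>y. norm (\<phi> y) \<le> 1" "\<And>y. blinfun_apply (\<phi> y) y = norm y"
    by metis
  \<comment> \<open>The empty sum, tested with a nonzero functional, forces the sign of
    \<open>C\<close>.\<close>
  have C: "0 \<le> C"
  proof -
    have "0 < norm (x undefined)"
      using \<epsilon>(1) \<epsilon>(2)[of undefined] by linarith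
    then have "0 < norm (\<phi> (x undefined))"
      using \<phi>(2)[of "x undefined"] by force
    then show ?thesis
      using wub[of "{}" "\<phi> (x undefined)"] by (simp add: zero_le_mult_iff)
  qed
  have wub1: "(\<Sum>i\<in>F. \<bar>blinfun_apply (\<phi> y) (x i)\<bar>) \<le> C" if "finite F" for F y
    using wub[OF that, of "\<phi> y"] mult_left_mono[OF \<phi>(1) C, of y] by simp
  \<comment> \<open>An infinite set is equipotent with its square; this supplies the copies of the
    index set.\<close>
  obtain \<pi> :: "'i \<times> 'i \<Rightarrow> 'i" where \<pi>: "inj \<pi>"
    using card_of_Times_same_infinite[OF inf] unfolding card_of_ordIso[symmetric]
    by (auto simp: bij_betw_def)
  \<comment> \<open>This \<open>n\<close> is the number of steps of size
    \<open>\<epsilon> / 2\<close> that exhaust the row bound \<open>C\<close>.\<close>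
  obtain n where "C / (\<epsilon> / 2) \<le> real n"
    using real_arch_simple by blast
  then have n: "C \<le> real n * (\<epsilon> / 2)"
    using \<epsilon>(1) by (simp add: field_simps)
  obtain h :: "'i \<Rightarrow> 'i" where h: "inj h"
    and small: "\<And>i F. finite F \<Longrightarrow> i \<notin> F \<Longrightarrow>
      (\<Sum>j\<in>F. \<bar>blinfun_apply (\<phi> (x (h i))) (x (h j))\<bar>) \<le> \<epsilon> / 2"
    using rosenthal_disjointification[OF \<pi>,
        of "\<lambda>i j. \<bar>blinfun_apply (\<phi> (x i)) (x j)\<bar>" n "\<epsilon> / 2"] order_trans[OF wub1 n] \<epsilon>(1)
    by auto
  show ?thesis
  proof (rule c0_embedding[of "\<lambda>i. x (h i)" C "\<epsilon> / 2"])
    fix F :: "'i set" and a :: "'i \<Rightarrow> real" and B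
    assume F: "finite F" and a: "\<And>i. i \<in> F \<Longrightarrow> \<bar>a i\<bar> \<le> B" and B: "0 \<le> B"
    define y where "y = (\<Sum>i\<in>F. a i *\<^sub>R x (h i))"
    have "norm y = (\<Sum>i\<in>F. a i * blinfun_apply (\<phi> y) (x (h i)))"
      unfolding \<phi>(2)[of y, symmetric]
      by (subst (2) y_def) (simp add: blinfun.sum_right blinfun.scaleR_right)
    also have "\<dots> \<le> (\<Sum>i\<in>F. B * \<bar>blinfun_apply (\<phi> y) (x (h i))\<bar>)"
    proof (rule sum_mono)
      fix i assume "i \<in> F"
      then have "\<bar>a i\<bar> * \<bar>blinfun_apply (\<phi> y) (x (h i))\<bar> \<le> B * \<bar>blinfun_apply (\<phi> y) (x (h i))\<bar>"
        by (intro mult_right_mono a) auto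
      then show "a i * blinfun_apply (\<phi> y) (x (h i)) \<le> B * \<bar>blinfun_apply (\<phi> y) (x (h i))\<bar>"
        using abs_ge_self[of "a i * blinfun_apply (\<phi> y) (x (h i))"] by (simp add: abs_mult)
    qed
    also have "\<dots> = B * (\<Sum>j\<in>h ` F. \<bar>blinfun_apply (\<phi> y) (x j)\<bar>)"
      using inj_on_subset[OF h] by (simp add: sum.reindex sum_distrib_left)
    also have "\<dots> \<le> B * C"
      using F B by (intro mult_left_mono wub1) auto
    finally show "norm (\<Sum>i\<in>F. a i *\<^sub>R x (h i)) \<le> C * B"
      by (simp add: y_def mult.commute)
  next
    fix F :: "'i set" and a :: "'i \<Rightarrow> real" and k
    assume F: "finite F" and k: "k \<in> F"
    \<comment> \<open>With the largest coefficient at \<open>i\<close>, the other terms contribute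
      at most half of the diagonal term.\<close>
    obtain i where i: "i \<in> F" and max: "\<And>j. j \<in> F \<Longrightarrow> \<bar>a j\<bar> \<le> \<bar>a i\<bar>"
    proof -
      have "Max ((\<lambda>j. \<bar>a j\<bar>) ` F) \<in> (\<lambda>j. \<bar>a j\<bar>) ` F"
        using F k by (intro Max_in) auto
      then obtain i where "i \<in> F" "Max ((\<lambda>j. \<bar>a j\<bar>) ` F) = \<bar>a i\<bar>" by blast
      moreover have "\<bar>a j\<bar> \<le> Max ((\<lambda>j. \<bar>a j\<bar>) ` F)" if "j \<in> F" for j
        using F that by (intro Max_ge) auto
      ultimately show ?thesis using that by metis
    qed
    let ?f = "\<phi> (x (h i))"
    have "\<bar>\<Sum>j\<in>F - {i}. a j * blinfun_apply ?f (x (h j))\<bar>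
        \<le> (\<Sum>j\<in>F - {i}. \<bar>a i\<bar> * \<bar>blinfun_apply ?f (x (h j))\<bar>)"
      by (intro order_trans[OF sum_abs] sum_mono) (auto simp: abs_mult intro!: mult_right_mono max)
    also have "\<dots> \<le> \<bar>a i\<bar> * (\<epsilon> / 2)"
      unfolding sum_distrib_left[symmetric] using F by (intro mult_left_mono small) auto
    finally have rest: "\<bar>\<Sum>j\<in>F - {i}. a j * blinfun_apply ?f (x (h j))\<bar> \<le> \<bar>a i\<bar> * (\<epsilon> / 2)" .
    have "\<bar>a i\<bar> * (\<epsilon> / 2) + \<bar>a i\<bar> * (\<epsilon> / 2) \<le> \<bar>a i * blinfun_apply ?f (x (h i))\<bar>"
      using mult_left_mono[OF \<epsilon>(2), of "\<bar>a i\<bar>" "h i"]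
      by (simp add: abs_mult \<phi>(2) mult.commute flip: distrib_left)
    moreover have "blinfun_apply ?f (\<Sum>j\<in>F. a j *\<^sub>R x (h j))
        = a i * blinfun_apply ?f (x (h i)) + (\<Sum>j\<in>F - {i}. a j * blinfun_apply ?f (x (h j)))"
      unfolding blinfun.sum_right blinfun.scaleR_right
      by (subst sum.remove[OF F i]) simp
    ultimately have "\<bar>a i\<bar> * (\<epsilon> / 2) \<le> \<bar>blinfun_apply ?f (\<Sum>j\<in>F. a j *\<^sub>R x (h j))\<bar>"
      using rest by linarith
    also have "\<dots> \<le> norm ?f * norm (\<Sum>j\<in>F. a j *\<^sub>R x (h j))"
      using norm_blinfun[of ?f "\<Sum>j\<in>F. a j *\<^sub>R x (h j)"] by simp
    also have "\<dots> \<le> 1 * norm (\<Sum>j\<in>F. a j *\<^sub>R x (h j))"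
      by (intro mult_right_mono \<phi>) auto
    finally have "\<bar>a i\<bar> * (\<epsilon> / 2) \<le> norm (\<Sum>j\<in>F. a j *\<^sub>R x (h j))" by simp
    moreover have "\<epsilon> / 2 * \<bar>a k\<bar> \<le> \<bar>a i\<bar> * (\<epsilon> / 2)"
      using max[OF k] \<epsilon>(1) by (simp add: mult.commute)
    ultimately show "\<epsilon> / 2 * \<bar>a k\<bar> \<le> norm (\<Sum>j\<in>F. a j *\<^sub>R x (h j))"
      by linarith
  qed (use \<epsilon> in simp)
qed

section \<open>Signed measures\<close>

lemma caD:
  assumes "\<nu> \<in> ca \<Sigma>"
  shows "\<nu> {} = 0"
    and "range A \<subseteq> \<Sigma> \<Longrightarrow> disjoint_family A \<Longrightarrow> (\<Union>n. A n) \<in> \<Sigma> \<Longrightarrow>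
      (\<lambda>n. \<nu> (A n)) sums \<nu> (\<Union>n::nat. A n)"
  using assms by (auto simp: ca_def)

lemma ca_uminus: "\<nu> \<in> ca \<Sigma> \<Longrightarrow> (\<lambda>A. - \<nu> A) \<in> ca \<Sigma>"
  by (auto simp: ca_def intro: sums_minus)

context sigma_algebra
begin

section \<open>Finite additivity, boundedness and total variation\<close>

lemma ca_Un:
  assumes "\<nu> \<in> ca M" "A \<in> M" "B \<in> M" "A \<inter> B = {}"
  shows "\<nu> (A \<union> B) = \<nu> A + \<nu> B"
proof -
  have "(\<lambda>n. \<nu> (binaryset A B n)) sums \<nu> (\<Union>n. binaryset A B n)"
    using assms by (intro caD(2))
      (auto simp: range_binaryset_eq UN_binaryset_eq disjoint_family_on_def binaryset_def)
  then show ?thesis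
    using sums_unique2[OF _ binaryset_sums[of \<nu> A B]] caD(1)[OF assms(1)]
    by (simp add: UN_binaryset_eq)
qed

lemma ca_Diff:
  assumes "\<nu> \<in> ca M" "A \<in> M" "B \<in> M" "B \<subseteq> A"
  shows "\<nu> (A - B) = \<nu> A - \<nu> B"
  using ca_Un[OF assms(1), of B "A - B"] assms by (simp add: Diff assms(4) Un_absorb1)

lemma ca_UN_finite:
  assumes \<nu>: "\<nu> \<in> ca M" and "finite F" "\<And>i. i \<in> F \<Longrightarrow> A i \<in> M" "disjoint_family_on A F"
  shows "\<nu> (\<Union>i\<in>F. A i) = (\<Sum>i\<in>F. \<nu> (A i))"
  using assms(2-)
proof (induction F)
  case (insert i F)
  then have "A i \<inter> (\<Union>j\<in>F. A j) = {}"
    by (auto simp: disjoint_family_on_def)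
  moreover have "(\<Union>j\<in>F. A j) \<in> M"
    using insert by (intro finite_UN) auto
  moreover have "disjoint_family_on A F"
    using insert.prems(2) by (auto simp: disjoint_family_on_def)
  ultimately show ?case
    using insert by (simp add: ca_Un[OF \<nu>])
qed (simp add: caD(1)[OF \<nu>])

text \<open>If \<open>\<nu>\<close> is unbounded on the subsets of \<open>E\<close>, then
  \<open>E\<close> splits into two pieces of absolute value at least 1, one of which is again bad.
  Iteration gives disjoint sets whose values do not tend to 0, against the convergence of their
  series.\<close>

theorem ca_bounded:
  assumes \<nu>: "\<nu> \<in> ca M"
  shows "\<exists>K. \<forall>A\<in>M. \<bar>\<nu> A\<bar> \<le> K"
proof (rule ccontr)
  define unbdd where "unbdd E \<longleftrightarrow> (\<forall>K. \<exists>A\<in>M. A \<subseteq> E \<and> K < \<bar>\<nu> A\<bar>)" for E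
  assume "\<not> ?thesis"
  then have "\<exists>A\<in>M. A \<subseteq> \<Omega> \<and> K < \<bar>\<nu> A\<bar>" for K
    using sets_into_space by (meson not_le)
  then have unbdd_top: "\<Omega> \<in> M \<and> unbdd \<Omega>"
    by (simp add: unbdd_def)
  have split: "\<exists>G. (G \<in> M \<and> unbdd G) \<and> G \<subseteq> E \<and> 1 \<le> \<bar>\<nu> (E - G)\<bar>" if E: "E \<in> M \<and> unbdd E" for E
  proof -
    \<comment> \<open>The margin \<open>\<bar>\<nu> E\<bar> + 1\<close> makes the values at
      \<open>B\<close> and at \<open>E - B\<close> both exceed 1 in absolute value, so either piece
      may be the one split off.\<close>
    obtain B where B: "B \<in> M" "B \<subseteq> E" "\<bar>\<nu> E\<bar> + 1 < \<bar>\<nu> B\<bar>"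
      using E unfolding unbdd_def by blast
    have D: "E - B \<in> M" "\<nu> (E - B) = \<nu> E - \<nu> B"
      using E B by (auto intro: ca_Diff[OF \<nu>])
    have "unbdd B \<or> unbdd (E - B)"
    proof (rule ccontr)
      assume "\<not> ?thesis"
      then have "\<not> unbdd B" "\<not> unbdd (E - B)" by simp_all
      then obtain K L where KL: "\<And>A. A \<in> M \<Longrightarrow> A \<subseteq> B \<Longrightarrow> \<bar>\<nu> A\<bar> \<le> K"
        "\<And>A. A \<in> M \<Longrightarrow> A \<subseteq> E - B \<Longrightarrow> \<bar>\<nu> A\<bar> \<le> L"
        unfolding unbdd_def by (meson not_le)
      have "\<bar>\<nu> A\<bar> \<le> K + L" if A: "A \<in> M" "A \<subseteq> E" for A
      proof -
        have "\<nu> A = \<nu> (A \<inter> B) + \<nu> (A - B)"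
          using ca_Un[OF \<nu>, of "A \<inter> B" "A - B"] A B by (auto simp: Int_Diff_Un)
        moreover have "\<bar>\<nu> (A \<inter> B)\<bar> \<le> K" "\<bar>\<nu> (A - B)\<bar> \<le> L"
          using A B(1) by (auto intro!: KL)
        ultimately show ?thesis by linarith
      qed
      with E show False
        unfolding unbdd_def by (meson not_le)
    qed
    then show ?thesis
    proof
      assume "unbdd B"
      then show ?thesis
        using B D by (intro exI[of _ B]) auto
    next
      assume "unbdd (E - B)"
      moreover have "E - (E - B) = B" using B by blast
      ultimately show ?thesis
        using B D by (intro exI[of _ "E - B"]) auto
    qed
  qed
  have "\<exists>G. \<forall>n. (G n \<in> M \<and> unbdd (G n)) \<and> G (Suc n) \<subseteq> G n \<and> 1 \<le> \<bar>\<nu> (G n - G (Suc n))\<bar>"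
    using unbdd_top split by (intro dependent_nat_choice) auto
  then obtain G where G: "\<And>n. G n \<in> M"
    and step: "\<And>n. G (Suc n) \<subseteq> G n" "\<And>n. 1 \<le> \<bar>\<nu> (G n - G (Suc n))\<bar>"
    by blast
  define D where "D n = G n - G (Suc n)" for n
  have mono: "G n \<subseteq> G m" if "m \<le> n" for m n
    by (rule lift_Suc_antimono_le[of G, OF step(1) that])
  have "disjoint_family D"
  proof -
    have "D m \<inter> D n = {}" if "m < n" for m n
      using mono[of "Suc m" n] that by (auto simp: D_def)
    then show ?thesis
      unfolding disjoint_family_on_def by (metis Int_commute nat_neq_iff)
  qed
  moreover have "range D \<subseteq> M"
    using G by (auto simp: D_def)
  ultimately have "(\<lambda>n. \<nu> (D n)) sums \<nu> (\<Union>n. D n)"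
    by (intro caD(2)[OF \<nu>]) auto
  then have "(\<lambda>n. \<nu> (D n)) \<longlonglongrightarrow> 0"
    using summable_LIMSEQ_zero sums_summable by blast
  then obtain n where "\<bar>\<nu> (D n)\<bar> < 1"
    by (metis LIMSEQ_D[of _ 0 1] diff_zero order_refl real_norm_def zero_less_one)
  with step(2)[of n] show False
    by (simp add: D_def)
qed

text \<open>\<open>ennreal\<close> truncates negative values to 0; this does not change the supremum, as \<open>B = {}\<close> gives 0.\<close>

definition pos_part :: "('a set \<Rightarrow> real) \<Rightarrow> 'a set \<Rightarrow> ennreal"
  where "pos_part \<nu> A = (SUP B\<in>{B \<in> M. B \<subseteq> A}. ennreal (\<nu> B))"

lemma pos_part_upper: "B \<in> M \<Longrightarrow> B \<subseteq> A \<Longrightarrow> ennreal (\<nu> B) \<le> pos_part \<nu> A"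
  unfolding pos_part_def by (intro SUP_upper) auto

lemma pos_part_least: "(\<And>B. B \<in> M \<Longrightarrow> B \<subseteq> A \<Longrightarrow> ennreal (\<nu> B) \<le> c) \<Longrightarrow> pos_part \<nu> A \<le> c"
  unfolding pos_part_def by (intro SUP_least) auto

lemma pos_part_Un_ge:
  assumes \<nu>: "\<nu> \<in> ca M" and "A \<inter> B = {}"
  shows "pos_part \<nu> A + pos_part \<nu> B \<le> pos_part \<nu> (A \<union> B)"
proof -
  \<comment> \<open>Additivity of \<open>\<nu>\<close> passes to \<open>ennreal\<close> for
    non-negative values. If one value is negative, its truncation is 0 and the other set alone is a
    competitor for the union.\<close>
  have "ennreal (\<nu> C) + ennreal (\<nu> D) \<le> pos_part \<nu> (A \<union> B)"
    if "C \<in> M" "C \<subseteq> A" "D \<in> M" "D \<subseteq> B" for C D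
  proof (cases "0 \<le> \<nu> C \<and> 0 \<le> \<nu> D")
    case True
    then have "ennreal (\<nu> C) + ennreal (\<nu> D) = ennreal (\<nu> (C \<union> D))"
      using that assms by (subst ca_Un[OF \<nu>]) (auto simp: ennreal_plus)
    also have "\<dots> \<le> pos_part \<nu> (A \<union> B)"
      using that by (intro pos_part_upper) auto
    finally show ?thesis .
  next
    case False
    then have "ennreal (\<nu> C) + ennreal (\<nu> D) \<in> {ennreal (\<nu> C), ennreal (\<nu> D)}"
      by (auto simp: ennreal_neg)
    then show ?thesis
      using that pos_part_upper[of C "A \<union> B" \<nu>] pos_part_upper[of D "A \<union> B" \<nu>]
      by (auto simp: le_supI1 le_supI2)
  qed
  then have *: "pos_part \<nu> A + ennreal (\<nu> D) \<le> pos_part \<nu> (A \<union> B)" if "D \<in> M" "D \<subseteq> B" for D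
    unfolding pos_part_def[of \<nu> A] using that
    by (subst ennreal_SUP_add_left[symmetric]) (auto intro!: SUP_least)
  then show ?thesis
    unfolding pos_part_def[of \<nu> B]
    by (subst ennreal_SUP_add_right) (auto intro!: SUP_least)
qed

text \<open>One inequality follows from superadditivity on finite unions. For the other, a
  competitor \<open>B\<close> for the union is cut into the competitors
  \<open>B \<inter> A n\<close>.\<close>

lemma countably_additive_pos_part:
  assumes \<nu>: "\<nu> \<in> ca M"
  shows "countably_additive M (pos_part \<nu>)"
proof (rule countably_additiveI)
  fix A :: "nat \<Rightarrow> 'a set"
  assume A: "range A \<subseteq> M" "disjoint_family A" "(\<Union>n. A n) \<in> M"
  show "(\<Sum>n. pos_part \<nu> (A n)) = pos_part \<nu> (\<Union>n. A n)"
  proof (rule antisym)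
    have mono: "pos_part \<nu> C \<le> pos_part \<nu> D" if "C \<subseteq> D" for C D
      using that by (intro pos_part_least pos_part_upper) auto
    have "(\<Sum>n<k. pos_part \<nu> (A n)) \<le> pos_part \<nu> (\<Union>n<k. A n)" for k
    proof (induction k)
      case (Suc k)
      have "A n \<inter> A k = {}" if "n < k" for n
        using A(2) that by (auto simp: disjoint_family_on_def)
      then have "(\<Union>n<k. A n) \<inter> A k = {}" by blast
      from pos_part_Un_ge[OF \<nu> this] Suc show ?case
        by (simp add: lessThan_Suc Un_commute add.commute) (meson add_left_mono order_trans)
    qed simp
    moreover have "pos_part \<nu> (\<Union>n<k. A n) \<le> pos_part \<nu> (\<Union>n. A n)" for k
      by (intro mono) auto
    ultimately show "(\<Sum>n. pos_part \<nu> (A n)) \<le> pos_part \<nu> (\<Union>n. A n)"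
      unfolding suminf_eq_SUP by (intro SUP_least) (blast intro: order_trans)
  next
    show "pos_part \<nu> (\<Union>n. A n) \<le> (\<Sum>n. pos_part \<nu> (A n))"
    proof (rule pos_part_least)
      fix B assume B: "B \<in> M" "B \<subseteq> (\<Union>n. A n)"
      have "(\<lambda>n. \<nu> (B \<inter> A n)) sums \<nu> (\<Union>n. B \<inter> A n)"
        using A B(1) by (intro caD(2)[OF \<nu>]) (auto simp: disjoint_family_on_def)
      also have "(\<Union>n. B \<inter> A n) = B"
        using B(2) by auto
      finally have "(\<lambda>k. ennreal (\<Sum>n<k. \<nu> (B \<inter> A n))) \<longlonglongrightarrow> ennreal (\<nu> B)"
        unfolding sums_def by (intro tendsto_ennrealI)
      moreover have "ennreal (\<Sum>n<k. \<nu> (B \<inter> A n)) \<le> (\<Sum>n. pos_part \<nu> (A n))" for k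
      proof -
        \<comment> \<open>Replacing the terms by their positive parts leaves their images under
          \<open>ennreal\<close> unchanged and lets \<open>ennreal\<close> commute with the
          sum.\<close>
        have "ennreal (\<Sum>n<k. \<nu> (B \<inter> A n)) \<le> ennreal (\<Sum>n<k. max 0 (\<nu> (B \<inter> A n)))"
          by (intro ennreal_leI sum_mono) auto
        also have "\<dots> = (\<Sum>n<k. ennreal (max 0 (\<nu> (B \<inter> A n))))"
          by simp
        also have "\<dots> = (\<Sum>n<k. ennreal (\<nu> (B \<inter> A n)))"
          by (intro sum.cong) (auto simp: max_def ennreal_neg)
        also have "\<dots> \<le> (\<Sum>n<k. pos_part \<nu> (A n))"
          using A(1) B(1) by (intro sum_mono pos_part_upper) auto
        also have "\<dots> \<le> (\<Sum>n. pos_part \<nu> (A n))"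
          by (intro sum_le_suminf) auto
        finally show ?thesis .
      qed
      ultimately show "ennreal (\<nu> B) \<le> (\<Sum>n. pos_part \<nu> (A n))"
        by (intro tendsto_upperbound[of _ _ sequentially]) auto
    qed
  qed
qed

text \<open>The measure is the total variation, built as the sum of the suprema for
  \<open>\<nu>\<close> and \<open>- \<nu>\<close> without a Hahn decomposition; it is finite because
  \<open>\<nu>\<close> is bounded.\<close>

theorem ca_control_measure:
  assumes \<nu>: "\<nu> \<in> ca M"
  obtains m where "space m = \<Omega>" "sets m = M" "finite_measure m"
    "\<And>A. A \<in> M \<Longrightarrow> emeasure m A = 0 \<longleftrightarrow> (\<forall>B\<in>M. B \<subseteq> A \<longrightarrow> \<nu> B = 0)"
proof -
  define \<nu>' where "\<nu>' A = - \<nu> A" for A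
  have \<nu>': "\<nu>' \<in> ca M"
    using ca_uminus[OF \<nu>] by (simp add: \<nu>'_def[abs_def])
  define m where "m = measure_of \<Omega> M (\<lambda>A. pos_part \<nu> A + pos_part \<nu>' A)"
  have space: "space m = \<Omega>" and sets: "sets m = M"
    unfolding m_def using space_closed by (auto simp: space_measure_of_conv sets_measure_of_eq)
  have empty: "pos_part \<mu> {} = 0" if "\<mu> \<in> ca M" for \<mu>
    using pos_part_least[of "{}" \<mu> 0] caD(1)[OF that] by auto
  have m: "emeasure m A = pos_part \<nu> A + pos_part \<nu>' A" if "A \<in> M" for A
    unfolding m_def
  proof (rule emeasure_measure_of_sigma[OF sigma_algebra_axioms _ _ that])
    show "positive M (\<lambda>A. pos_part \<nu> A + pos_part \<nu>' A)"
      by (simp add: positive_def empty \<nu> \<nu>')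
    show "countably_additive M (\<lambda>A. pos_part \<nu> A + pos_part \<nu>' A)"
      using countably_additive_pos_part[OF \<nu>] countably_additive_pos_part[OF \<nu>']
      by (simp add: countably_additive_def flip: suminf_add)
  qed
  obtain K where K: "\<And>A. A \<in> M \<Longrightarrow> \<bar>\<nu> A\<bar> \<le> K"
    using ca_bounded[OF \<nu>] by blast
  have "pos_part \<nu> \<Omega> \<le> ennreal K" "pos_part \<nu>' \<Omega> \<le> ennreal K"
    using K by (auto intro!: pos_part_least ennreal_leI simp: \<nu>'_def abs_le_iff)
  then have "emeasure m (space m) \<le> ennreal K + ennreal K"
    unfolding space m[OF top] by (rule add_mono)
  then have fin: "finite_measure m"
    by (intro finite_measureI) (auto simp: top_unique)
  have "emeasure m A = 0 \<longleftrightarrow> (\<forall>B\<in>M. B \<subseteq> A \<longrightarrow> \<nu> B = 0)" if "A \<in> M" for A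
  proof
    assume "emeasure m A = 0"
    then have 0: "pos_part \<nu> A = 0" "pos_part \<nu>' A = 0"
      using m[OF that] by auto
    show "\<forall>B\<in>M. B \<subseteq> A \<longrightarrow> \<nu> B = 0"
    proof safe
      fix B assume B: "B \<in> M" "B \<subseteq> A"
      have "ennreal (\<nu> B) = 0" "ennreal (\<nu>' B) = 0"
        using pos_part_upper[OF B, of \<nu>] pos_part_upper[OF B, of \<nu>'] 0 by simp_all
      then show "\<nu> B = 0"
        by (simp add: \<nu>'_def ennreal_eq_0_iff)
    qed
  next
    assume "\<forall>B\<in>M. B \<subseteq> A \<longrightarrow> \<nu> B = 0"
    then have "pos_part \<nu> A \<le> 0" and "pos_part \<nu>' A \<le> 0"
      by (auto intro!: pos_part_least simp: \<nu>'_def simp del: le_zero_eq)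
    then show "emeasure m A = 0"
      by (simp add: m[OF that])
  qed
  from that[OF space sets fin this] show ?thesis .
qed

end

section \<open>Dominating measures under the countable chain condition\<close>

text \<open>Zorn's lemma for inclusion. A member that is disjoint from all members is empty, so the
  last property is contradictory for any such \<open>E\<close> once \<open>P\<close> excludes the
  empty set.\<close>

lemma maximal_disjoint:
  obtains \<F> where "disjoint \<F>" "\<And>E. E \<in> \<F> \<Longrightarrow> P E"
    "\<And>E. P E \<Longrightarrow> (\<And>F. F \<in> \<F> \<Longrightarrow> E \<inter> F = {}) \<Longrightarrow> E \<in> \<F>"
proof -
  define S where "S = {\<F>. disjoint \<F> \<and> (\<forall>E\<in>\<F>. P E)}"
  have "\<exists>\<F>\<in>S. \<forall>\<G>\<in>S. \<F> \<subseteq> \<G> \<longrightarrow> \<G> = \<F>"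
  proof (rule subset_Zorn')
    fix C assume C: "subset.chain S C"
    have "disjoint (\<Union>C)"
    proof (rule disjointI)
      fix A B assume "A \<in> \<Union>C" "B \<in> \<Union>C" and "A \<noteq> B"
      then obtain X Y where XY: "X \<in> C" "A \<in> X" "Y \<in> C" "B \<in> Y" by blast
      then have "X \<subseteq> Y \<or> Y \<subseteq> X" "disjoint X" "disjoint Y"
        using C by (auto simp: subset_chain_def S_def)
      with XY \<open>A \<noteq> B\<close> show "A \<inter> B = {}"
        by (meson disjointD in_mono)
    qed
    with C show "\<Union>C \<in> S"
      by (auto simp: subset_chain_def S_def)
  qed
  then obtain \<F> where "\<F> \<in> S" and max: "\<And>\<G>. \<G> \<in> S \<Longrightarrow> \<F> \<subseteq> \<G> \<Longrightarrow> \<G> = \<F>"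
    by metis
  then have \<F>: "disjoint \<F>" "\<And>E. E \<in> \<F> \<Longrightarrow> P E"
    by (simp_all add: S_def)
  have "E \<in> \<F>" if "P E" "\<And>F. F \<in> \<F> \<Longrightarrow> E \<inter> F = {}" for E
  proof -
    have "disjoint (insert E \<F>)"
      unfolding pairwise_insert using \<F>(1) that(2) by (simp add: disjnt_def Int_commute)
    then have "insert E \<F> \<in> S"
      using \<F>(2) that(1) by (simp add: S_def)
    then have "insert E \<F> = \<F>"
      by (rule max) blast
    then show ?thesis by blast
  qed
  with \<F> show ?thesis by (rule that)
qed

text \<open>Cardinals are comparable, so an uncountable one exceeds \<open>natLeq\<close> and hence
  dominates its successor, the cardinality of \<open>omega1\<close>.\<close>

lemma uncountable_omega1_embedding:
  includes cardinal_syntax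
  assumes "uncountable S"
  obtains h :: "omega1 \<Rightarrow> 'a" where "inj h" "range h \<subseteq> S"
proof -
  have "\<not> |S| \<le>o natLeq"
  proof
    assume "|S| \<le>o natLeq"
    then have "|S| \<le>o |UNIV :: nat set|"
      using card_of_nat ordIso_symmetric ordLeq_ordIso_trans by blast
    with assms show False
      unfolding countable_def card_of_ordLeq[symmetric] by auto
  qed
  then have "natLeq <o |S|"
    using not_ordLeq_iff_ordLess natLeq_Well_order card_of_Well_order by blast
  then have "cardSuc natLeq \<le>o |S|"
    by (intro cardSuc_least natLeq_Card_order card_of_Card_order)
  then have "|UNIV :: omega1 set| \<le>o |S|"
    using card_of_omega1 ordIso_ordLeq_trans by blast
  then show ?thesis
    using that unfolding card_of_ordLeq[symmetric] by blast
qed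

lemma finite_measure_dominating_sequence:
  fixes m :: "nat \<Rightarrow> 'w measure"
  assumes sets: "\<And>n. sets (m n) = sets N" and fin: "\<And>n. finite_measure (m n)"
  obtains \<mu> where "sets \<mu> = sets N" "finite_measure \<mu>"
    "\<And>A n. A \<in> sets N \<Longrightarrow> emeasure \<mu> A = 0 \<Longrightarrow> emeasure (m n) A = 0"
proof -
  \<comment> \<open>The 1 in the denominator excludes division by 0; the weights are positive and
    the weighted total masses are bounded by a series with sum 1.\<close>
  define w where "w n = (1 / 2) ^ Suc n / (1 + measure (m n) (space N))" for n
  have w: "0 < w n" "w n * measure (m n) (space N) \<le> (1 / 2) ^ Suc n" for n
  proof -
    have *: "0 < 1 + measure (m n) (space N)"
      using measure_nonneg[of "m n" "space N"] by linarith
    then show "0 < w n" by (simp add: w_def)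
    show "w n * measure (m n) (space N) \<le> (1 / 2) ^ Suc n"
      using * by (simp add: w_def divide_simps)
  qed
  \<comment> \<open>Written as an integral over the counting measure, the series can be interchanged
    with the sum over disjoint sets.\<close>
  define f where "f A = (\<integral>\<^sup>+ n. ennreal (w n) * emeasure (m n) A \<partial>count_space UNIV)" for A
  define \<mu> where "\<mu> = measure_of (space N) (sets N) f"
  have \<mu>: "emeasure \<mu> A = f A" if "A \<in> sets N" for A
    unfolding \<mu>_def
  proof (rule emeasure_measure_of_sigma[OF sets.sigma_algebra_axioms _ _ that])
    show "positive (sets N) f"
      by (simp add: positive_def f_def)
    show "countably_additive (sets N) f"
    proof (rule countably_additiveI)
      fix A :: "nat \<Rightarrow> 'w set"
      assume A: "range A \<subseteq> sets N" "disjoint_family A"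
      have "(\<Sum>i. f (A i)) = (\<integral>\<^sup>+ n. (\<Sum>i. ennreal (w n) * emeasure (m n) (A i)) \<partial>count_space UNIV)"
        unfolding f_def by (rule nn_integral_suminf[symmetric]) simp
      also have "\<dots> = f (\<Union>i. A i)"
        using A by (simp add: f_def suminf_emeasure sets)
      finally show "(\<Sum>i. f (A i)) = f (\<Union>i. A i)" .
    qed
  qed
  have sets_\<mu>: "sets \<mu> = sets N"
    by (simp add: \<mu>_def)
  have "emeasure \<mu> (space \<mu>) = (\<Sum>n. ennreal (w n) * emeasure (m n) (space N))"
    using sets_eq_imp_space_eq[OF sets_\<mu>] by (simp add: \<mu> f_def nn_integral_count_space_nat)
  also have "\<dots> \<le> (\<Sum>n. ennreal ((1 / 2) ^ Suc n))"
  proof (rule suminf_le)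
    fix n
    show "ennreal (w n) * emeasure (m n) (space N) \<le> ennreal ((1 / 2) ^ Suc n)"
      using w[of n] by (simp only: finite_measure.emeasure_eq_measure[OF fin])
        (simp flip: ennreal_mult add: ennreal_leI)
  qed auto
  also have "\<dots> = ennreal 1"
    by (rule suminf_ennreal_eq[OF _ power_half_series]) simp
  finally have "finite_measure \<mu>"
    by (intro finite_measureI) (auto simp: top_unique)
  moreover have "emeasure (m n) A = 0" if A: "A \<in> sets N" "emeasure \<mu> A = 0" for A n
  proof -
    have "(\<Sum>n. ennreal (w n) * emeasure (m n) A) = 0"
      using A by (simp add: \<mu> f_def nn_integral_count_space_nat)
    then have "ennreal (w n) * emeasure (m n) A = 0"
      by (simp add: suminf_eq_zero_iff)
    with w(1)[of n] show ?thesis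
      by (simp add: ennreal_eq_0_iff not_le)
  qed
  ultimately show ?thesis
    using that sets_\<mu> by blast
qed

text \<open>Every nonnull set contains a nonnull part on which a single \<open>m i\<close> detects
  all nonnull subsets. A maximal disjoint family of such parts is countable, so countably many
  indices suffice.\<close>

theorem ccc_dominating_measure:
  fixes m :: "'i \<Rightarrow> 'w measure"
  assumes sets: "\<And>i. sets (m i) = sets N" and fin: "\<And>i. finite_measure (m i)"
    and ccc: "\<And>\<F>. disjoint \<F> \<Longrightarrow> \<forall>A\<in>\<F>. A \<in> sets N \<and> (\<exists>i. emeasure (m i) A \<noteq> 0) \<Longrightarrow> countable \<F>"
  obtains \<mu> where "sets \<mu> = sets N" "finite_measure \<mu>"
    "\<And>A i. A \<in> sets N \<Longrightarrow> emeasure \<mu> A = 0 \<Longrightarrow> emeasure (m i) A = 0"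
proof -
  define nonnull where "nonnull A \<longleftrightarrow> A \<in> sets N \<and> (\<exists>i. emeasure (m i) A \<noteq> 0)" for A
  have ccc': "countable \<F>" if "disjoint \<F>" "\<forall>A\<in>\<F>. nonnull A" for \<F>
    using ccc[OF that(1)] that(2) unfolding nonnull_def by blast
  define dominates where
    "dominates i E \<longleftrightarrow> (\<forall>B. nonnull B \<longrightarrow> B \<subseteq> E \<longrightarrow> emeasure (m i) B \<noteq> 0)" for i E
  have ex_dominated: "\<exists>E i. nonnull E \<and> E \<subseteq> A \<and> dominates i E" if A: "nonnull A" for A
  proof -
    obtain i where A': "A \<in> sets N" and i: "emeasure (m i) A \<noteq> 0"
      using A by (auto simp: nonnull_def)
    \<comment> \<open>These are the parts of \<open>A\<close> that \<open>m i\<close> misses. By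
      countability their union is null for \<open>m i\<close>; removing it preserves the mass, and
      by maximality \<open>m i\<close> misses no nonnull subset of the rest.\<close>
    obtain \<F> where \<F>: "disjoint \<F>"
        "\<And>B. B \<in> \<F> \<Longrightarrow> nonnull B \<and> B \<subseteq> A \<and> emeasure (m i) B = 0"
      and max: "\<And>B. nonnull B \<and> B \<subseteq> A \<and> emeasure (m i) B = 0 \<Longrightarrow>
        (\<And>F. F \<in> \<F> \<Longrightarrow> B \<inter> F = {}) \<Longrightarrow> B \<in> \<F>"
      using maximal_disjoint[of "\<lambda>B. nonnull B \<and> B \<subseteq> A \<and> emeasure (m i) B = 0"] by metis
    have "countable \<F>"
      using \<F> by (intro ccc') auto
    then have "(\<Union>B\<in>\<F>. B) \<in> null_sets (m i)"
      using \<F>(2) by (intro null_sets_UN') (auto simp: null_sets_def sets nonnull_def)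
    then have null: "\<Union>\<F> \<in> null_sets (m i)" by simp
    then have "emeasure (m i) (A - \<Union>\<F>) = emeasure (m i) A"
      using A' by (intro emeasure_Diff_null_set) (auto simp: sets)
    moreover have "A - \<Union>\<F> \<in> sets N"
      using null A' by (auto simp: null_sets_def sets)
    ultimately have "nonnull (A - \<Union>\<F>)"
      using i unfolding nonnull_def by metis
    moreover have "dominates i (A - \<Union>\<F>)"
      unfolding dominates_def
    proof (intro allI impI notI)
      fix B assume B: "nonnull B" "B \<subseteq> A - \<Union>\<F>" "emeasure (m i) B = 0"
      then have "B \<in> \<F>" by (intro max conjI) blast+
      with B have "B = {}" by blast
      with B(1) show False by (simp add: nonnull_def)
    qed
    ultimately show ?thesis by blast
  qed
  obtain \<E> where \<E>: "disjoint \<E>" "\<And>E. E \<in> \<E> \<Longrightarrow> nonnull E \<and> (\<exists>i. dominates i E)"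
    and max: "\<And>E. nonnull E \<and> (\<exists>i. dominates i E) \<Longrightarrow>
      (\<And>F. F \<in> \<E> \<Longrightarrow> E \<inter> F = {}) \<Longrightarrow> E \<in> \<E>"
    using maximal_disjoint[of "\<lambda>E. nonnull E \<and> (\<exists>i. dominates i E)"] by metis
  have count: "countable \<E>"
    using \<E> by (intro ccc') auto
  obtain k where k: "\<And>E. E \<in> \<E> \<Longrightarrow> dominates (k E) E"
    using \<E>(2) by metis
  \<comment> \<open>If \<open>\<E>\<close> is empty, \<open>from_nat_into\<close> returns an
    arbitrary set and \<open>m' n\<close> is still one of the given finite measures.\<close>
  define m' where "m' n = m (k (from_nat_into \<E> n))" for n
  obtain \<mu> where \<mu>: "sets \<mu> = sets N" "finite_measure \<mu>"
    and dom: "\<And>A n. A \<in> sets N \<Longrightarrow> emeasure \<mu> A = 0 \<Longrightarrow> emeasure (m' n) A = 0"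
    using finite_measure_dominating_sequence[of m' N] sets fin by (auto simp: m'_def)
  have "emeasure (m i) A = 0" if A: "A \<in> sets N" "emeasure \<mu> A = 0" for A i
  proof (rule ccontr)
    assume *: "emeasure (m i) A \<noteq> 0"
    \<comment> \<open>Since \<open>A\<close> is null for the measure that dominates on
      \<open>E\<close>, the part of \<open>A\<close> in \<open>E\<close> is null for all of them.
      What remains of \<open>A\<close> outside the family would then contain a new dominated set,
      against maximality.\<close>
    have "A \<inter> E \<in> null_sets (m i)" if E: "E \<in> \<E>" for E
    proof -
      obtain n where "from_nat_into \<E> n = E"
        using from_nat_into_surj[OF count E] by blast
      then have "emeasure (m (k E)) A = 0"
        using dom[OF A, of n] by (simp add: m'_def)
      then have "emeasure (m (k E)) (A \<inter> E) = 0"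
        using emeasure_mono[of "A \<inter> E" A "m (k E)"] A(1) by (simp add: sets)
      then have "\<not> nonnull (A \<inter> E)"
        using k[OF E] by (auto simp: dominates_def)
      then show ?thesis
        using A(1) \<E>(2)[OF E] by (auto simp: nonnull_def null_sets_def sets)
    qed
    then have "(\<Union>E\<in>\<E>. A \<inter> E) \<in> null_sets (m i)"
      by (intro null_sets_UN' count)
    then have null: "A \<inter> \<Union>\<E> \<in> null_sets (m i)"
      unfolding Int_Union .
    then have "emeasure (m i) (A - A \<inter> \<Union>\<E>) = emeasure (m i) A"
      using A by (intro emeasure_Diff_null_set) (auto simp: sets)
    moreover have "A - A \<inter> \<Union>\<E> \<in> sets N"
      using null A by (auto simp: null_sets_def sets)
    ultimately have "nonnull (A - A \<inter> \<Union>\<E>)"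
      using * unfolding nonnull_def by metis
    from ex_dominated[OF this] obtain E j where E: "nonnull E" "E \<subseteq> A - A \<inter> \<Union>\<E>" "dominates j E"
      by blast
    then have "E \<in> \<E>" by (intro max conjI) blast+
    with E(2) have "E = {}" by blast
    with E(1) show False by (simp add: nonnull_def)
  qed
  with \<mu> that show ?thesis by blast
qed

section \<open>Multimeasures\<close>

lemma support_fun_upper:
  assumes "bounded C" "y \<in> C"
  shows "blinfun_apply f y \<le> support_fun f C"
  unfolding support_fun_def
  by (intro cSUP_upper assms bounded_imp_bdd_above bounded_linear_image blinfun.bounded_linear_right)

lemma support_fun_zero: "support_fun f {0} = 0"
  by (simp add: support_fun_def)

lemma eq_singleton_zero_of_support_fun:
  assumes "bounded C" "C \<noteq> {}" "\<And>f. support_fun f C = 0"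
  shows "C = {0}"
proof -
  have "y = 0" if "y \<in> C" for y
  proof -
    obtain f :: "'a \<Rightarrow>\<^sub>L real" where "blinfun_apply f y = norm y"
      using norming_functional by blast
    then show ?thesis
      using support_fun_upper[OF assms(1) that, of f] assms(3)[of f] by simp
  qed
  with assms(2) show ?thesis by blast
qed

text \<open>Each \<open>s(f, M(A))\<close> is bounded as \<open>A\<close> varies; using this for
  \<open>f\<close> and \<open>- f\<close> shows that the range is weakly bounded, hence norm
  bounded.\<close>

lemma multimeasure_bounded_range:
  fixes M :: "'w set \<Rightarrow> 'a::real_normed_vector set"
  assumes "sigma_algebra \<Omega> \<Sigma>" and M: "multimeasure \<Sigma> M"
  shows "bounded (\<Union>A\<in>\<Sigma>. M A)"
proof (rule bounded_of_weakly_bounded)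
  interpret sigma_algebra \<Omega> \<Sigma> by fact
  have "\<exists>K. \<forall>A\<in>\<Sigma>. \<forall>y\<in>M A. blinfun_apply g y \<le> K" for g :: "'a \<Rightarrow>\<^sub>L real"
  proof -
    obtain K where "\<forall>A\<in>\<Sigma>. \<bar>support_fun g (M A)\<bar> \<le> K"
      using ca_bounded[of "\<lambda>A. support_fun g (M A)"] M by (auto simp: multimeasure_def)
    moreover have "blinfun_apply g y \<le> support_fun g (M A)" if "A \<in> \<Sigma>" "y \<in> M A" for A y
      using M that by (intro support_fun_upper) (auto simp: multimeasure_def)
    ultimately show ?thesis by (meson abs_le_D1 order_trans)
  qed
  then obtain K where K: "\<And>(g :: 'a \<Rightarrow>\<^sub>L real) A y. A \<in> \<Sigma> \<Longrightarrow> y \<in> M A \<Longrightarrow> blinfun_apply g y \<le> K g"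
    by metis
  fix f :: "'a \<Rightarrow>\<^sub>L real"
  have "norm (blinfun_apply f y) \<le> max (K f) (K (- f))" if "A \<in> \<Sigma>" "y \<in> M A" for A y
    using K[OF that, of f] K[OF that, of "- f"] by (simp add: blinfun.minus_left)
  then show "bounded (blinfun_apply f ` (\<Union>A\<in>\<Sigma>. M A))"
    unfolding bounded_iff by blast
qed

text \<open>Support functions dominate the values \<open>f (x i)\<close>, and additivity collects
  them into one support function of a set in the bounded range. Splitting the indices by sign and
  using both \<open>f\<close> and \<open>- f\<close> gives the constant
  \<open>2 * K\<close>.\<close>

lemma multimeasure_selection_weakly_bounded:
  fixes M :: "'w set \<Rightarrow> 'a::real_normed_vector set"
  assumes "sigma_algebra \<Omega> \<Sigma>" and M: "multimeasure \<Sigma> M"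
    and D: "\<And>i. D i \<in> \<Sigma>" "disjoint_family D" and x: "\<And>i. x i \<in> M (D i)"
  shows "\<exists>C. \<forall>(f :: 'a \<Rightarrow>\<^sub>L real) F. finite F \<longrightarrow>
    (\<Sum>i\<in>F. \<bar>blinfun_apply f (x i)\<bar>) \<le> C * norm f"
proof -
  interpret sigma_algebra \<Omega> \<Sigma> by fact
  have bdd: "\<And>A. A \<in> \<Sigma> \<Longrightarrow> bounded (M A)" and ne: "\<And>A. A \<in> \<Sigma> \<Longrightarrow> M A \<noteq> {}"
    and ca: "\<And>f. (\<lambda>A. support_fun f (M A)) \<in> ca \<Sigma>"
    using M by (auto simp: multimeasure_def)
  obtain K where K: "\<And>A y. A \<in> \<Sigma> \<Longrightarrow> y \<in> M A \<Longrightarrow> norm y \<le> K"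
    using multimeasure_bounded_range[OF assms(1,2)] by (auto simp: bounded_iff)
  have le: "(\<Sum>i\<in>F. blinfun_apply f (x i)) \<le> norm f * K" if F: "finite F" for f F
  proof -
    have "(\<Sum>i\<in>F. blinfun_apply f (x i)) \<le> (\<Sum>i\<in>F. support_fun f (M (D i)))"
      by (intro sum_mono support_fun_upper bdd D x)
    also have "\<dots> = support_fun f (M (\<Union>i\<in>F. D i))"
      using D by (intro ca_UN_finite[OF ca F, symmetric]) (auto simp: disjoint_family_on_def)
    also have "\<dots> \<le> norm f * K"
      unfolding support_fun_def
    proof (rule cSUP_least)
      have U: "(\<Union>i\<in>F. D i) \<in> \<Sigma>"
        using F D(1) by (intro finite_UN) auto
      then show "M (\<Union>i\<in>F. D i) \<noteq> {}" by (rule ne)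
      fix y assume "y \<in> M (\<Union>i\<in>F. D i)"
      then have "norm f * norm y \<le> norm f * K"
        by (intro mult_left_mono K[OF U]) auto
      then show "blinfun_apply f y \<le> norm f * K"
        using norm_blinfun[of f y] by simp
    qed
    finally show ?thesis .
  qed
  have "(\<Sum>i\<in>F. \<bar>blinfun_apply f (x i)\<bar>) \<le> (2 * K) * norm f" if F: "finite F" for f F
  proof -
    let ?P = "{i \<in> F. 0 \<le> blinfun_apply f (x i)}"
    have "(\<Sum>i\<in>F. \<bar>blinfun_apply f (x i)\<bar>)
        = (\<Sum>i\<in>F - ?P. \<bar>blinfun_apply f (x i)\<bar>) + (\<Sum>i\<in>?P. \<bar>blinfun_apply f (x i)\<bar>)"
      using F by (intro sum.subset_diff) auto
    also have "\<dots> = (\<Sum>i\<in>F - ?P. blinfun_apply (- f) (x i)) + (\<Sum>i\<in>?P. blinfun_apply f (x i))"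
      by (intro arg_cong2[where f = "(+)"] sum.cong) (auto simp: blinfun.minus_left)
    also have "\<dots> \<le> norm (- f) * K + norm f * K"
      using F by (intro add_mono le) auto
    finally show ?thesis by (simp add: algebra_simps)
  qed
  then show ?thesis by blast
qed

lemma multimeasure_uncountable_imp_c0:
  fixes M :: "'w set \<Rightarrow> 'a::banach set"
  assumes \<Sigma>: "sigma_algebra \<Omega> \<Sigma>" and M: "multimeasure \<Sigma> M"
    and \<F>: "disjoint \<F>" "\<And>A. A \<in> \<F> \<Longrightarrow> \<exists>B\<in>\<Sigma>. B \<subseteq> A \<and> M B \<noteq> {0}" "uncountable \<F>"
  shows "\<exists>Y (T :: omega1 c0 \<Rightarrow> 'a). subspace Y \<and> closed Y \<and> isomorphism_onto T Y"
proof -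
  have "\<exists>B y. B \<in> \<Sigma> \<and> B \<subseteq> A \<and> y \<in> M B \<and> y \<noteq> 0" if A: "A \<in> \<F>" for A
  proof -
    obtain B where B: "B \<in> \<Sigma>" "B \<subseteq> A" "M B \<noteq> {0}"
      using \<F>(2)[OF A] by blast
    moreover have "M B \<noteq> {}"
      using M B(1) by (simp add: multimeasure_def)
    ultimately show ?thesis by blast
  qed
  then obtain B y where By: "\<And>A. A \<in> \<F> \<Longrightarrow> B A \<in> \<Sigma>" "\<And>A. A \<in> \<F> \<Longrightarrow> B A \<subseteq> A"
    "\<And>A. A \<in> \<F> \<Longrightarrow> y A \<in> M (B A)" "\<And>A. A \<in> \<F> \<Longrightarrow> y A \<noteq> 0"
    by metis
  \<comment> \<open>A countable union of countable sets is countable, so one threshold works for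
    uncountably many members; this gives the uniform lower bound on the norms.\<close>
  have "\<exists>n. inverse (real (Suc n)) \<le> norm (y A)" if "A \<in> \<F>" for A
    using reals_Archimedean[of "norm (y A)"] By(4)[OF that] by (auto intro: less_imp_le)
  then have "\<F> = (\<Union>n. {A \<in> \<F>. inverse (real (Suc n)) \<le> norm (y A)})"
    by blast
  then obtain n where "uncountable {A \<in> \<F>. inverse (real (Suc n)) \<le> norm (y A)}"
    using \<F>(3) countable_UN[of UNIV "\<lambda>n. {A \<in> \<F>. inverse (real (Suc n)) \<le> norm (y A)}"] by auto
  then obtain h :: "omega1 \<Rightarrow> 'w set" where h: "inj h"
    "range h \<subseteq> {A \<in> \<F>. inverse (real (Suc n)) \<le> norm (y A)}"
    by (rule uncountable_omega1_embedding)
  then have h\<F>: "h i \<in> \<F>" and large: "inverse (real (Suc n)) \<le> norm (y (h i))" for i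
    by auto
  have "B (h i) \<inter> B (h j) = {}" if "i \<noteq> j" for i j
  proof -
    have "h i \<inter> h j = {}"
      using \<F>(1) h\<F> that h(1) by (auto simp: pairwise_def disjnt_def inj_eq)
    then show ?thesis
      using By(2)[OF h\<F>, of i] By(2)[OF h\<F>, of j] by blast
  qed
  then have disj: "disjoint_family (\<lambda>i. B (h i))"
    by (simp add: disjoint_family_on_def)
  obtain C where
    bound: "\<And>(f :: 'a \<Rightarrow>\<^sub>L real) F. finite F \<Longrightarrow>
      (\<Sum>i\<in>F. \<bar>blinfun_apply f (y (h i))\<bar>) \<le> C * norm f"
    using multimeasure_selection_weakly_bounded[OF \<Sigma> M By(1)[OF h\<F>] disj By(3)[OF h\<F>]] by blast
  have "0 < inverse (real (Suc n))" by simp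
  from c0_copy_of_weakly_unconditionally_bounded[OF uncountable_infinite[OF uncountable_omega1]
      bound this large]
  show ?thesis .
qed

theorem corollary3:
  fixes \<Omega> :: "'w set" and \<Sigma> :: "'w set set"
    and M :: "'w set \<Rightarrow> 'a::banach set"
  assumes "sigma_algebra \<Omega> \<Sigma>"
    and "\<not> (\<exists>(Y :: 'a set) (T :: omega1 c0 \<Rightarrow> 'a).
              subspace Y \<and> closed Y \<and> isomorphism_onto T Y)"
    and "multimeasure \<Sigma> M"
  shows "\<exists>\<mu>. control_measure \<Omega> \<Sigma> M \<mu>"
proof -
  interpret sigma_algebra \<Omega> \<Sigma> by fact
  have M: "\<And>A. A \<in> \<Sigma> \<Longrightarrow> bounded (M A)" "\<And>A. A \<in> \<Sigma> \<Longrightarrow> M A \<noteq> {}"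
    and ca: "\<And>f. (\<lambda>A. support_fun f (M A)) \<in> ca \<Sigma>"
    using assms(3) by (auto simp: multimeasure_def)
  \<comment> \<open>For each functional this is the total variation of its support function.\<close>
  have "\<exists>m. space m = \<Omega> \<and> sets m = \<Sigma> \<and> finite_measure m \<and>
      (\<forall>A\<in>\<Sigma>. emeasure m A = 0 \<longleftrightarrow> (\<forall>B\<in>\<Sigma>. B \<subseteq> A \<longrightarrow> support_fun f (M B) = 0))" for f
    using ca_control_measure[OF ca[of f]] by metis
  then obtain m where m: "\<And>f. space (m f) = \<Omega>" "\<And>f. sets (m f) = \<Sigma>" "\<And>f. finite_measure (m f)"
    and null: "\<And>f A. A \<in> \<Sigma> \<Longrightarrow>
      emeasure (m f) A = 0 \<longleftrightarrow> (\<forall>B\<in>\<Sigma>. B \<subseteq> A \<longrightarrow> support_fun f (M B) = 0)"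
    by metis
  \<comment> \<open>Here \<open>m 0\<close> only names the \<sigma>-algebra, which all the
    \<open>m f\<close> share.\<close>
  obtain \<mu> where \<mu>: "sets \<mu> = sets (m 0)" "finite_measure \<mu>"
    and dom: "\<And>A f. A \<in> sets (m 0) \<Longrightarrow> emeasure \<mu> A = 0 \<Longrightarrow> emeasure (m f) A = 0"
  proof (rule ccc_dominating_measure[of m "m 0"])
    fix \<F> assume \<F>: "disjoint \<F>" "\<forall>A\<in>\<F>. A \<in> sets (m 0) \<and> (\<exists>f. emeasure (m f) A \<noteq> 0)"
    have "\<exists>B\<in>\<Sigma>. B \<subseteq> A \<and> M B \<noteq> {0}" if "A \<in> \<F>" for A
    proof -
      obtain f where "emeasure (m f) A \<noteq> 0" "A \<in> \<Sigma>"
        using \<F>(2) \<open>A \<in> \<F>\<close> m(2) by blast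
      then obtain B where B: "B \<in> \<Sigma>" "B \<subseteq> A" "support_fun f (M B) \<noteq> 0"
        using null by blast
      then have "M B \<noteq> {0}"
        using support_fun_zero by metis
      with B show ?thesis by blast
    qed
    then show "countable \<F>"
      using multimeasure_uncountable_imp_c0[OF assms(1,3) \<F>(1)] assms(2) by blast
  qed (use m in auto)
  \<comment> \<open>A set that is null for every \<open>m f\<close> has all support functions 0,
    since it is one of its own subsets; norming functionals then exclude nonzero points of
    \<open>M A\<close>.\<close>
  have "M A = {0}" if "A \<in> \<Sigma>" "emeasure \<mu> A = 0" for A
  proof (rule eq_singleton_zero_of_support_fun)
    fix f
    have "emeasure (m f) A = 0"
      using that by (intro dom) (simp_all add: m(2))
    then show "support_fun f (M A) = 0"
      using null[OF that(1)] that(1) by blast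
  qed (use M that in auto)
  then have "control_measure \<Omega> \<Sigma> M \<mu>"
    using \<mu> m sets_eq_imp_space_eq[OF \<mu>(1)] by (simp add: control_measure_def)
  then show ?thesis ..
qed

end
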